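(* Let $(p_{ij} \colon X_j \to X_i)_{i \sqsubseteq j \in I}$ be a projective system of topological spaces, with canonical projective limit $X, (p_i)_{i \in I}$. Let $\bullet$ be nothing, "$\leq 1$" or "$1$". If: 1. the projective system is an ep-system, 2. or $I$ has a countable cofinal subset and each $X_i$ is locally compact sober (and compact, if $\bullet$ is "$1$"), 3. or every $X_i$ is $\odot$-consonant sober (and compact if $\bullet$ is "$1$") and every $p_{ij}$ is a proper map, then $(\mathbb P_{\mathtt{AP}}^\bullet\, p_{ij} \colon \mathbb P_{\mathtt{AP}}^\bullet X_j \to \mathbb P_{\mathtt{AP}}^\bullet X_i)_{i \sqsubseteq j \in I}$ is a projective system of topological spaces, and $\mathbb P_{\mathtt{AP}}^\bullet X, (\mathbb P_{\mathtt{AP}}^\bullet\, p_i)_{i \in I}$ is its projective limit, up to homeomorphism.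
   Context: **Topology.** $\mathcal O X$ is the lattice of open subsets of $X$. The specialization preordering is: $x \leq y$ iff every open neighborhood of $x$ contains $y$; $\downarrow A$ denotes downward closure. A subset is saturated iff it is upwards-closed. Compactness is the open cover property, with no separation axiom. A space is locally compact iff every point has a base of compact neighborhoods; sober iff it is $T_0$ and every irreducible closed subset is the closure of a point; consonant iff for every Scott-open subset $\mathcal U$ of $\mathcal O X$ and every $U \in \mathcal U$, there is a compact saturated $Q \subseteq U$ all of whose open neighborhoods belong to $\mathcal U$; $\odot$-consonant iff for every $n \in \mathbb N$ the topological sum of $n$ copies of $X$ is consonant. A continuous map $f \colon X \to Y$ is proper iff $\downarrow f[F]$ is closed for every closed $F \subseteq X$ and $f^{-1}(Q)$ is compact saturated for every compact saturated $Q \subseteq Y$. **Projective systems.** A projective system $(p_{ij} \colon X_j \to X_i)_{i \sqsubseteq j \in I}$ consists of a directed preordered set $(I,\sqsubseteq)$, spaces $X_i$, and continuous maps $p_{ij}$ ($i \sqsubseteq j$) with $p_{ii} = \mathrm{id}$ and $p_{ij} \circ p_{jk} = p_{ik}$ for $i \sqsubseteq j \sqsubseteq k$. Its canonical projective limit is $X = \{\vec x \in \prod_{i} X_i \mid p_{ij}(x_j) = x_i \text{ for all } i \sqsubseteq j\}$ with the subspace topology of the product, $p_i$ being projection onto coordinate $i$. Saying that $Y, (q_i)_{i\in I}$ is the projective limit up to homeomorphism of a projective system with canonical limit $Z$ means that $y \mapsto (q_i(y))_{i \in I}$ is a (well-defined) homeomorphism from $Y$ onto $Z$. The system is an ep-system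 iff there are continuous maps $e_{ij} \colon X_i \to X_j$ ($i \sqsubseteq j$) with $p_{ij} \circ e_{ij} = \mathrm{id}$, $e_{ij} \circ p_{ij} \leq \mathrm{id}$ (pointwise, in the specialization preordering), $e_{ii} = \mathrm{id}$, and $e_{jk} \circ e_{ij} = e_{ik}$. **Previsions.** $\overline{\mathbb R}_+ = \mathbb R_+ \cup \{\infty\}$. $\mathcal L X$ is the set of lower semicontinuous maps from $X$ to $\overline{\mathbb R}_+$ (continuous for the Scott topology on $\overline{\mathbb R}_+$), ordered pointwise. A prevision on $X$ is a Scott-continuous map $F \colon \mathcal L X \to \overline{\mathbb R}_+$ with $F(ah)=aF(h)$ for all $a \in \mathbb R_+$, $h \in \mathcal L X$. It is sublinear iff $F(h+h') \leq F(h)+F(h')$ for all $h,h'$; subnormalized (resp. normalized) iff $F(\mathbf 1+h) \leq 1+F(h)$ (resp. $=$) for all $h$, where $\mathbf 1$ is the constant function $1$. $\mathbb P_{\mathtt{AP}} X$, $\mathbb P_{\mathtt{AP}}^{\leq 1} X$, $\mathbb P_{\mathtt{AP}}^{1} X$ are the spaces of sublinear, subnormalized sublinear, normalized sublinear previsions on $X$, with topology generated by $\{F \mid F(h)>r\}$, $h \in \mathcal L X$, $r \in \mathbb R_+$. Each is an endofunctor on topological spaces; a continuous map $f \colon X \to Y$ acts by $F \mapsto (h \in \mathcal L Y \mapsto F(h \circ f))$. *)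

theory Defs
  imports "HOL-Analysis.Analysis"
begin

text \<open>
  A space is an abstract topology, its points being the elements of its \<open>topspace\<close>. A map that is
  itself a point of some space (an element of a product, a lower semicontinuous map, a prevision) is
  represented extensionally, i.e. with the value \<open>undefined\<close> off its domain.
\<close>

subsection \<open>Directed sets and the Scott topology\<close>

definition directed_on :: "'a set \<Rightarrow> ('a \<Rightarrow> 'a \<Rightarrow> bool) \<Rightarrow> bool" where
  "directed_on D le \<longleftrightarrow> D \<noteq> {} \<and> (\<forall>x\<in>D. \<forall>y\<in>D. \<exists>z\<in>D. le x z \<and> le y z)"

definition is_lub_in :: "'a::order set \<Rightarrow> 'a set \<Rightarrow> 'a \<Rightarrow> bool" where
  "is_lub_in A D s \<longleftrightarrow>
     s \<in> A \<and> (\<forall>x\<in>D. x \<le> s) \<and> (\<forall>u\<in>A. (\<forall>x\<in>D. x \<le> u) \<longrightarrow> s \<le> u)"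

definition scott_open_in :: "'a::order set \<Rightarrow> 'a set \<Rightarrow> bool" where
  "scott_open_in A U \<longleftrightarrow>
     U \<subseteq> A \<and> (\<forall>x\<in>U. \<forall>y\<in>A. x \<le> y \<longrightarrow> y \<in> U) \<and>
     (\<forall>D s. D \<subseteq> A \<and> directed_on D (\<le>) \<and> is_lub_in A D s \<and> s \<in> U \<longrightarrow> D \<inter> U \<noteq> {})"

definition scott_topology :: "'a::order set \<Rightarrow> 'a topology" where
  "scott_topology A = topology (scott_open_in A)"

lemma istopology_scott_open_in: "istopology (scott_open_in A)"
  unfolding istopology_def
proof (intro conjI allI impI)
  fix S T assume S: "scott_open_in A S" and T: "scott_open_in A T"
  show "scott_open_in A (S \<inter> T)"
    unfolding scott_open_in_def
  proof (intro conjI allI impI ballI)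
    show "S \<inter> T \<subseteq> A" using S by (auto simp: scott_open_in_def)
  next
    fix x y assume "x \<in> S \<inter> T" "y \<in> A" "x \<le> y"
    then show "y \<in> S \<inter> T" using S T by (auto simp: scott_open_in_def)
  next
    fix D s assume D: "D \<subseteq> A \<and> directed_on D (\<le>) \<and> is_lub_in A D s \<and> s \<in> S \<inter> T"
    then have "D \<inter> S \<noteq> {}" using S unfolding scott_open_in_def by (meson IntD1)
    moreover have "D \<inter> T \<noteq> {}" using D T unfolding scott_open_in_def by (meson IntD2)
    ultimately obtain x y where xy: "x \<in> D" "x \<in> S" "y \<in> D" "y \<in> T" by auto
    with D obtain z where z: "z \<in> D" "x \<le> z" "y \<le> z" unfolding directed_on_def by meson
    then have "z \<in> A" using D by auto
    then have "z \<in> S" "z \<in> T" using z xy S T unfolding scott_open_in_def by meson+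
    then show "D \<inter> (S \<inter> T) \<noteq> {}" using z(1) by auto
  qed
next
  fix \<K> assume K: "\<forall>K\<in>\<K>. scott_open_in A K"
  show "scott_open_in A (\<Union>\<K>)"
    unfolding scott_open_in_def
  proof (intro conjI allI impI ballI)
    show "\<Union>\<K> \<subseteq> A" using K by (auto simp: scott_open_in_def)
  next
    fix x y assume "x \<in> \<Union>\<K>" "y \<in> A" "x \<le> y"
    then show "y \<in> \<Union>\<K>" using K unfolding scott_open_in_def by (meson UnionE UnionI)
  next
    fix D s assume D: "D \<subseteq> A \<and> directed_on D (\<le>) \<and> is_lub_in A D s \<and> s \<in> \<Union>\<K>"
    then obtain K where "K \<in> \<K>" "s \<in> K" by auto
    then have "D \<inter> K \<noteq> {}" using D \<open>\<forall>K\<in>\<K>. scott_open_in A K\<close> unfolding scott_open_in_def by meson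
    then show "D \<inter> \<Union>\<K> \<noteq> {}" using \<open>K \<in> \<K>\<close> by auto
  qed
qed

lemma openin_scott_topology: "openin (scott_topology A) U \<longleftrightarrow> scott_open_in A U"
  by (simp add: scott_topology_def topology_inverse'[OF istopology_scott_open_in])

definition scott_continuous_on :: "'a::order set \<Rightarrow> 'b::order set \<Rightarrow> ('a \<Rightarrow> 'b) \<Rightarrow> bool" where
  "scott_continuous_on A B f \<longleftrightarrow>
     f ` A \<subseteq> B \<and> mono_on A f \<and>
     (\<forall>D s. D \<subseteq> A \<and> directed_on D (\<le>) \<and> is_lub_in A D s \<longrightarrow> is_lub_in B (f ` D) (f s))"

subsection \<open>Topological notions\<close>

definition specialization :: "'a topology \<Rightarrow> 'a \<Rightarrow> 'a \<Rightarrow> bool" where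
  "specialization X x y \<longleftrightarrow>
     x \<in> topspace X \<and> y \<in> topspace X \<and> (\<forall>U. openin X U \<and> x \<in> U \<longrightarrow> y \<in> U)"

definition down_closure :: "'a topology \<Rightarrow> 'a set \<Rightarrow> 'a set" where
  "down_closure X A = {x. \<exists>y\<in>A. specialization X x y}"

definition saturated_in :: "'a topology \<Rightarrow> 'a set \<Rightarrow> bool" where
  "saturated_in X A \<longleftrightarrow> A \<subseteq> topspace X \<and> (\<forall>x\<in>A. \<forall>y. specialization X x y \<longrightarrow> y \<in> A)"

text \<open>
  Without separation axioms this is stronger than \<^const>\<open>locally_compact_space\<close>, which asks for a
  single compact neighborhood of each point.
\<close>
definition locally_compact_base :: "'a topology \<Rightarrow> bool" where
  "locally_compact_base X \<longleftrightarrow> neighbourhood_base_of (compactin X) X"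

definition irreducible_closed_in :: "'a topology \<Rightarrow> 'a set \<Rightarrow> bool" where
  "irreducible_closed_in X C \<longleftrightarrow>
     closedin X C \<and> C \<noteq> {} \<and>
     (\<forall>A B. closedin X A \<and> closedin X B \<and> C \<subseteq> A \<union> B \<longrightarrow> C \<subseteq> A \<or> C \<subseteq> B)"

definition sober_space :: "'a topology \<Rightarrow> bool" where
  "sober_space X \<longleftrightarrow>
     t0_space X \<and>
     (\<forall>C. irreducible_closed_in X C \<longrightarrow> (\<exists>x\<in>topspace X. C = X closure_of {x}))"

definition consonant_space :: "'a topology \<Rightarrow> bool" where
  "consonant_space X \<longleftrightarrow>
     (\<forall>\<U>. scott_open_in {U. openin X U} \<U> \<longrightarrow>
        (\<forall>U\<in>\<U>. \<exists>Q. compactin X Q \<and> saturated_in X Q \<and> Q \<subseteq> U \<and>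
                     (\<forall>V. openin X V \<and> Q \<subseteq> V \<longrightarrow> V \<in> \<U>)))"

definition odot_consonant_space :: "'a topology \<Rightarrow> bool" where
  "odot_consonant_space X \<longleftrightarrow> (\<forall>n::nat. consonant_space (sum_topology (\<lambda>_. X) {..<n}))"

text \<open>
  This differs from \<^const>\<open>proper_map\<close> (closed with compact fibers): only the downward closure of
  the image of a closed set has to be closed.
\<close>
definition order_proper_map :: "'a topology \<Rightarrow> 'b topology \<Rightarrow> ('a \<Rightarrow> 'b) \<Rightarrow> bool" where
  "order_proper_map X Y f \<longleftrightarrow>
     continuous_map X Y f \<and>
     (\<forall>F. closedin X F \<longrightarrow> closedin Y (down_closure Y (f ` F))) \<and>
     (\<forall>Q. compactin Y Q \<and> saturated_in Y Q \<longrightarrow>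
          compactin X {x \<in> topspace X. f x \<in> Q} \<and> saturated_in X {x \<in> topspace X. f x \<in> Q})"

subsection \<open>Projective systems\<close>

text \<open>The map \<open>p i j\<close> goes from \<open>X j\<close> to \<open>X i\<close>.\<close>

definition projective_system ::
    "'i set \<Rightarrow> ('i \<Rightarrow> 'i \<Rightarrow> bool) \<Rightarrow> ('i \<Rightarrow> 'a topology) \<Rightarrow> ('i \<Rightarrow> 'i \<Rightarrow> 'a \<Rightarrow> 'a) \<Rightarrow> bool" where
  "projective_system I le X p \<longleftrightarrow>
     reflp_on I le \<and> transp_on I le \<and> directed_on I le \<and>
     (\<forall>i\<in>I. \<forall>j\<in>I. le i j \<longrightarrow> continuous_map (X j) (X i) (p i j)) \<and>
     (\<forall>i\<in>I. \<forall>x\<in>topspace (X i). p i i x = x) \<and>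
     (\<forall>i\<in>I. \<forall>j\<in>I. \<forall>k\<in>I. le i j \<and> le j k \<longrightarrow>
        (\<forall>x\<in>topspace (X k). p i j (p j k x) = p i k x))"

definition projective_limit ::
    "'i set \<Rightarrow> ('i \<Rightarrow> 'i \<Rightarrow> bool) \<Rightarrow> ('i \<Rightarrow> 'a topology) \<Rightarrow> ('i \<Rightarrow> 'i \<Rightarrow> 'a \<Rightarrow> 'a)
      \<Rightarrow> ('i \<Rightarrow> 'a) topology" where
  "projective_limit I le X p =
     subtopology (product_topology X I)
       {x \<in> (\<Pi>\<^sub>E i\<in>I. topspace (X i)). \<forall>i\<in>I. \<forall>j\<in>I. le i j \<longrightarrow> p i j (x j) = x i}"

definition is_projective_limit ::
    "'i set \<Rightarrow> ('i \<Rightarrow> 'i \<Rightarrow> bool) \<Rightarrow> ('i \<Rightarrow> 'a topology) \<Rightarrow> ('i \<Rightarrow> 'i \<Rightarrow> 'a \<Rightarrow> 'a)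
      \<Rightarrow> 'b topology \<Rightarrow> ('i \<Rightarrow> 'b \<Rightarrow> 'a) \<Rightarrow> bool" where
  "is_projective_limit I le X p Y q \<longleftrightarrow>
     homeomorphic_map Y (projective_limit I le X p) (\<lambda>y. \<lambda>i\<in>I. q i y)"

definition ep_system ::
    "'i set \<Rightarrow> ('i \<Rightarrow> 'i \<Rightarrow> bool) \<Rightarrow> ('i \<Rightarrow> 'a topology) \<Rightarrow> ('i \<Rightarrow> 'i \<Rightarrow> 'a \<Rightarrow> 'a) \<Rightarrow> bool" where
  "ep_system I le X p \<longleftrightarrow>
     projective_system I le X p \<and>
     (\<exists>e :: 'i \<Rightarrow> 'i \<Rightarrow> 'a \<Rightarrow> 'a.
        (\<forall>i\<in>I. \<forall>j\<in>I. le i j \<longrightarrow>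
           continuous_map (X i) (X j) (e i j) \<and>
           (\<forall>x\<in>topspace (X i). p i j (e i j x) = x) \<and>
           (\<forall>x\<in>topspace (X j). specialization (X j) (e i j (p i j x)) x)) \<and>
        (\<forall>i\<in>I. \<forall>x\<in>topspace (X i). e i i x = x) \<and>
        (\<forall>i\<in>I. \<forall>j\<in>I. \<forall>k\<in>I. le i j \<and> le j k \<longrightarrow>
           (\<forall>x\<in>topspace (X i). e j k (e i j x) = e i k x)))"

definition has_countable_cofinal_subset :: "'i set \<Rightarrow> ('i \<Rightarrow> 'i \<Rightarrow> bool) \<Rightarrow> bool" where
  "has_countable_cofinal_subset I le \<longleftrightarrow> (\<exists>J\<subseteq>I. countable J \<and> (\<forall>i\<in>I. \<exists>j\<in>J. le i j))"

subsection \<open>Previsions\<close>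

text \<open>
  By extensionality, the order of the function type restricts to the pointwise order over
  \<open>topspace X\<close> on this set.
\<close>
definition lsc_maps :: "'a topology \<Rightarrow> ('a \<Rightarrow> ennreal) set" where
  "lsc_maps X = {h \<in> extensional (topspace X). continuous_map X (scott_topology UNIV) h}"

definition prevision :: "'a topology \<Rightarrow> (('a \<Rightarrow> ennreal) \<Rightarrow> ennreal) \<Rightarrow> bool" where
  "prevision X F \<longleftrightarrow>
     F \<in> extensional (lsc_maps X) \<and>
     scott_continuous_on (lsc_maps X) UNIV F \<and>
     (\<forall>a::real. \<forall>h\<in>lsc_maps X. 0 \<le> a \<longrightarrow>
        F (\<lambda>x\<in>topspace X. ennreal a * h x) = ennreal a * F h)"

definition sublinear_on :: "'a topology \<Rightarrow> (('a \<Rightarrow> ennreal) \<Rightarrow> ennreal) \<Rightarrow> bool" where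
  "sublinear_on X F \<longleftrightarrow>
     (\<forall>h\<in>lsc_maps X. \<forall>h'\<in>lsc_maps X. F (\<lambda>x\<in>topspace X. h x + h' x) \<le> F h + F h')"

definition subnormalized_on :: "'a topology \<Rightarrow> (('a \<Rightarrow> ennreal) \<Rightarrow> ennreal) \<Rightarrow> bool" where
  "subnormalized_on X F \<longleftrightarrow> (\<forall>h\<in>lsc_maps X. F (\<lambda>x\<in>topspace X. 1 + h x) \<le> 1 + F h)"

definition normalized_on :: "'a topology \<Rightarrow> (('a \<Rightarrow> ennreal) \<Rightarrow> ennreal) \<Rightarrow> bool" where
  "normalized_on X F \<longleftrightarrow> (\<forall>h\<in>lsc_maps X. F (\<lambda>x\<in>topspace X. 1 + h x) = 1 + F h)"

text \<open>The three values of the superscript \<open>\<bullet>\<close>: nothing, \<open>\<le> 1\<close> and \<open>1\<close>.\<close>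
datatype normality = Unrestricted | Subnormalized | Normalized

fun satisfies_normality ::
    "normality \<Rightarrow> 'a topology \<Rightarrow> (('a \<Rightarrow> ennreal) \<Rightarrow> ennreal) \<Rightarrow> bool" where
  "satisfies_normality Unrestricted X F \<longleftrightarrow> True"
| "satisfies_normality Subnormalized X F \<longleftrightarrow> subnormalized_on X F"
| "satisfies_normality Normalized X F \<longleftrightarrow> normalized_on X F"

definition AP_previsions :: "normality \<Rightarrow> 'a topology \<Rightarrow> (('a \<Rightarrow> ennreal) \<Rightarrow> ennreal) set" where
  "AP_previsions b X = {F. prevision X F \<and> sublinear_on X F \<and> satisfies_normality b X F}"

text \<open>
  The whole carrier is added to the subbase because the zero prevision lies in no set
  \<open>{F. F h > r}\<close>, while the \<open>topspace\<close> of a generated topology is the union of its generators.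
\<close>
definition AP_space :: "normality \<Rightarrow> 'a topology \<Rightarrow> (('a \<Rightarrow> ennreal) \<Rightarrow> ennreal) topology" where
  "AP_space b X =
     topology_generated_by
       (insert (AP_previsions b X)
          {{F \<in> AP_previsions b X. ennreal r < F h} | h r. h \<in> lsc_maps X \<and> 0 \<le> (r::real)})"

definition AP_map ::
    "'a topology \<Rightarrow> 'b topology \<Rightarrow> ('a \<Rightarrow> 'b)
      \<Rightarrow> (('a \<Rightarrow> ennreal) \<Rightarrow> ennreal) \<Rightarrow> (('b \<Rightarrow> ennreal) \<Rightarrow> ennreal)" where
  "AP_map X Y f F = (\<lambda>h\<in>lsc_maps Y. F (\<lambda>x\<in>topspace X. h (f x)))"

end

theory Submission
  imports Defs
begin

text \<open>
  Let \<open>lim\<close> be the limit of the system \<open>X\<close>. By directedness, the sets of threads \<open>x\<close> with \<open>x i \<in> V\<close>, for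
  \<open>i\<close> an index and \<open>V\<close> open in \<open>X i\<close>, form a base of \<open>lim\<close>. Hence every lower semicontinuous \<open>h\<close> on \<open>lim\<close> is
  the directed supremum of its best approximations from each coordinate, \<open>lower_approx h i\<close> being the
  largest lower semicontinuous \<open>g\<close> on \<open>X i\<close> with \<open>g (x i) \<le> h x\<close> for all threads \<open>x\<close>. A prevision on \<open>lim\<close> is
  therefore determined by its images on the \<open>X i\<close> (\<open>prevision_on_lim\<close>), and a compatible family \<open>F\<close> of
  previsions can only come from \<open>h \<mapsto> (SUP i. F i (lower_approx h i))\<close>, which is called \<open>glue F\<close>. This formula
  also shows that the comparison map is a homeomorphism onto its image: \<open>glue F h > r\<close> holds as soon as
  \<open>F i (lower_approx h i) > r\<close> for one \<open>i\<close>, which is an open condition on \<open>F i\<close>.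

  Everything thus reduces to surjectivity, that is, to showing that \<open>glue F\<close> is a prevision whose images are
  the \<open>F i\<close>. The obstruction is that \<open>lower_approx h i\<close> tests an inequality on threads only, and the
  coordinate maps of \<open>lim\<close> need not be surjective. The condition that overcomes it is \<open>limit_monotone F\<close>: whenever
  an increasing family \<open>h j\<close> on the \<open>X j\<close> dominates, along all threads, a function \<open>g\<close> on one \<open>X i\<close>, then
  \<open>F i g \<le> (SUP j. F j (h j))\<close>. Under this condition \<open>glue F\<close> may be computed from any increasing family
  with the right pointwise supremum (\<open>glue_SUP\<close>), and Scott continuity, homogeneity, sublinearity and the
  normality conditions are inherited from the \<open>F i\<close>.

  The three cases of the theorem are three proofs of \<open>limit_monotone F\<close>.

  For an ep-system, the embeddings turn each point of \<open>X i\<close> into a thread, so that \<open>g \<le> (SUP j. h j \<circ> e i j)\<close> on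
  \<open>X i\<close>. Scott continuity of \<open>F i\<close> and \<open>e i j \<circ> p i j \<le> id\<close> conclude (\<open>ep_limit_monotone\<close>).

  In the other two cases, fix \<open>t < F i g\<close>. By Scott continuity \<open>F i\<close> already exceeds \<open>t\<close> on a step function with
  finitely many levels \<open>r m\<close> carried by the open sets \<open>{g > r m}\<close>. These are replaced by compact saturated sets
  \<open>K m j \<subseteq> X j\<close>, compatible with the bonding maps and large enough to force \<open>F j (h j) > t\<close> as soon as
  \<open>h j > r m\<close> on \<open>K m j\<close> for all \<open>m\<close>. All threads in \<open>K m\<close> lie in \<open>{g > r m}\<close>, hence in the union of the
  \<open>{h j > r m}\<close>. A compactness theorem for inverse systems of compact saturated sets in sober spaces
  (\<open>compact_family_inside_open\<close>) then provides one \<open>j\<close> with \<open>K m j \<subseteq> {h j > r m}\<close>.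

  If the spaces are consonant for all finite sums and the bonding maps are proper, one application of
  consonance in the \<open>n\<close>-fold sum of \<open>X i\<close> yields compact sets \<open>Q m\<close>, and \<open>K m j\<close> is the preimage of \<open>Q m\<close>.
  If the spaces are locally compact, preimages of compact sets need not be compact; instead one moves along
  a cofinal sequence of indices and chooses at each stage, inside the preimage of the interior kept at
  the previous stage, a new compact set whose interior still carries a value above \<open>t\<close>.
\<close>

section \<open>Lower semicontinuous maps\<close>

lemma scott_open_ennreal_iff:
  "scott_open_in (UNIV :: ennreal set) U \<longleftrightarrow> U = UNIV \<or> (\<exists>t. U = {t<..})"
proof
  assume U: "scott_open_in UNIV U"
  show "U = UNIV \<or> (\<exists>t. U = {t<..})"
  proof (cases "U = UNIV")
    case False
    define s where "s = Sup (- U)"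
    have up: "x \<in> U \<Longrightarrow> x \<le> y \<Longrightarrow> y \<in> U" for x y
      using U unfolding scott_open_in_def by blast
    have "directed_on (- U) (\<le>)"
      using False unfolding directed_on_def by (metis ComplI UNIV_eq_I empty_iff linear order_refl)
    moreover have "is_lub_in UNIV (- U) s"
      unfolding is_lub_in_def s_def by (auto intro: Sup_upper Sup_least)
    ultimately have "s \<notin> U"
      using U unfolding scott_open_in_def by blast
    then have "U = {s<..}"
      using up by (auto simp: s_def) (metis ComplI Sup_upper linorder_not_le order.order_iff_strict)+
    then show ?thesis by blast
  qed simp
next
  assume "U = UNIV \<or> (\<exists>t. U = {t<..})"
  then show "scott_open_in UNIV U"
  proof
    assume "U = UNIV"
    then show ?thesis
      by (auto simp: scott_open_in_def directed_on_def)
  next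
    assume "\<exists>t. U = {t<..}"
    then show ?thesis
      by (auto simp: scott_open_in_def is_lub_in_def) (meson disjoint_iff greaterThan_iff linorder_not_le order_less_le_trans)+
  qed
qed

lemma lsc_maps_iff:
  "h \<in> lsc_maps X \<longleftrightarrow>
     h \<in> extensional (topspace X) \<and> (\<forall>t. openin X {x \<in> topspace X. t < h x})"
proof -
  have top: "topspace (scott_topology (UNIV::ennreal set)) = UNIV"
    by (metis UNIV_I openin_scott_topology openin_subset scott_open_ennreal_iff subset_antisym subset_UNIV)
  have "continuous_map X (scott_topology UNIV) h \<longleftrightarrow> (\<forall>t. openin X {x \<in> topspace X. t < h x})"
  proof
    assume h: "continuous_map X (scott_topology UNIV) h"
    show "\<forall>t. openin X {x \<in> topspace X. t < h x}"
    proof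
      fix t :: ennreal
      have "openin (scott_topology UNIV) {t<..}"
        by (auto simp: openin_scott_topology scott_open_ennreal_iff)
      from openin_continuous_map_preimage[OF h this]
      show "openin X {x \<in> topspace X. t < h x}" by simp
    qed
  next
    assume h: "\<forall>t. openin X {x \<in> topspace X. t < h x}"
    show "continuous_map X (scott_topology UNIV) h"
      unfolding continuous_map_def top openin_scott_topology scott_open_ennreal_iff
      using h by auto
  qed
  then show ?thesis by (simp add: lsc_maps_def)
qed

lemma lsc_mapsI:
  assumes "\<And>t. openin X {x \<in> topspace X. t < h x}"
  shows "(\<lambda>x\<in>topspace X. h x) \<in> lsc_maps X"
proof -
  have "{x \<in> topspace X. t < (\<lambda>x\<in>topspace X. h x) x} = {x \<in> topspace X. t < h x}" for t
    by auto
  then show ?thesis using assms by (simp add: lsc_maps_iff)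
qed

lemma lsc_maps_openin: "h \<in> lsc_maps X \<Longrightarrow> openin X {x \<in> topspace X. t < h x}"
  by (simp add: lsc_maps_iff)

lemma lsc_maps_restrict: "h \<in> lsc_maps X \<Longrightarrow> (\<lambda>x\<in>topspace X. h x) = h"
  by (auto simp: lsc_maps_iff extensional_restrict)

lemma lsc_maps_le_iff:
  assumes "h \<in> lsc_maps X" "g \<in> lsc_maps X"
  shows "h \<le> g \<longleftrightarrow> (\<forall>x\<in>topspace X. h x \<le> g x)"
proof -
  have "h x = g x" if "x \<notin> topspace X" for x
    using assms that by (simp add: lsc_maps_iff extensional_def)
  then show ?thesis unfolding le_fun_def by (metis order_refl)
qed

lemma lsc_maps_specialization:
  assumes "h \<in> lsc_maps X" "specialization X x y"
  shows "h x \<le> h y"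
proof (rule ccontr)
  assume "\<not> h x \<le> h y"
  then have "x \<in> {z \<in> topspace X. h y < h z}" "y \<notin> {z \<in> topspace X. h y < h z}"
    using assms by (auto simp: specialization_def)
  then show False
    using assms lsc_maps_openin[OF assms(1)] unfolding specialization_def by blast
qed

lemma lsc_maps_SUP:
  assumes "\<And>i. i \<in> A \<Longrightarrow> f i \<in> lsc_maps X"
  shows "(\<lambda>x\<in>topspace X. SUP i\<in>A. f i x) \<in> lsc_maps X"
proof (rule lsc_mapsI)
  fix t
  have "{x \<in> topspace X. t < (SUP i\<in>A. f i x)} = (\<Union>i\<in>A. {x \<in> topspace X. t < f i x})"
    by (auto simp: less_SUP_iff)
  then show "openin X {x \<in> topspace X. t < (SUP i\<in>A. f i x)}"
    using assms by (auto intro!: openin_Union lsc_maps_openin)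
qed

lemma is_lub_in_lsc_maps:
  assumes "D \<subseteq> lsc_maps X"
  shows "is_lub_in (lsc_maps X) D s \<longleftrightarrow> s = (\<lambda>x\<in>topspace X. SUP h\<in>D. h x)"
proof -
  let ?s = "\<lambda>x\<in>topspace X. SUP h\<in>D. h x"
  have s: "?s \<in> lsc_maps X" using assms by (intro lsc_maps_SUP) auto
  have lub: "is_lub_in (lsc_maps X) D ?s"
    unfolding is_lub_in_def
  proof (intro conjI ballI impI s)
    fix h assume h: "h \<in> D"
    show "h \<le> ?s"
      using h assms by (subst lsc_maps_le_iff[OF _ s]) (auto intro: SUP_upper2)
  next
    fix u assume u: "u \<in> lsc_maps X" "\<forall>x\<in>D. x \<le> u"
    show "?s \<le> u"
      using u by (subst lsc_maps_le_iff[OF s]) (auto simp: le_fun_def intro: SUP_least)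
  qed
  moreover have "is_lub_in (lsc_maps X) D s \<Longrightarrow> s = ?s"
    using lub unfolding is_lub_in_def by (meson antisym)
  ultimately show ?thesis by blast
qed

lemma lsc_maps_pullback:
  assumes "continuous_map X Y f" "h \<in> lsc_maps Y"
  shows "(\<lambda>x\<in>topspace X. h (f x)) \<in> lsc_maps X"
proof (rule lsc_mapsI)
  fix t
  have "{x \<in> topspace X. t < h (f x)} = {x \<in> topspace X. f x \<in> {y \<in> topspace Y. t < h y}}"
    using assms(1) by (auto simp: continuous_map_def)
  then show "openin X {x \<in> topspace X. t < h (f x)}"
    using openin_continuous_map_preimage[OF assms(1) lsc_maps_openin[OF assms(2)]] by simp
qed

text \<open>
  The hypothesis says that \<open>\<phi>\<close> is continuous from below. The element \<open>0\<close> is added to \<open>{..<u}\<close> only to keep the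
  index set nonempty at \<open>u = 0\<close>, where a translation \<open>\<phi>\<close> has a nonzero value.
\<close>
lemma lsc_maps_compose_from_below:
  assumes h: "h \<in> lsc_maps X" and \<phi>: "\<And>u. \<phi> u = (SUP b\<in>insert 0 {..<u}. \<phi> b)"
  shows "(\<lambda>x\<in>topspace X. \<phi> (h x)) \<in> lsc_maps X"
proof (rule lsc_mapsI)
  fix t :: ennreal
  have *: "t < \<phi> u \<longleftrightarrow> t < \<phi> 0 \<or> (\<exists>b<u. t < \<phi> b)" for u
    by (subst \<phi>) (simp only: less_SUP_iff, auto)
  have "{x \<in> topspace X. t < \<phi> (h x)} =
      {x \<in> topspace X. t < \<phi> 0 \<or> (\<exists>b<h x. t < \<phi> b)}"
    using *[of "h _"] by (intro Collect_cong conj_cong refl) blast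
  also have "\<dots> = (if t < \<phi> 0 then topspace X else \<Union>b\<in>{b. t < \<phi> b}. {x \<in> topspace X. b < h x})"
    by auto
  finally have "{x \<in> topspace X. t < \<phi> (h x)} =
      (if t < \<phi> 0 then topspace X else \<Union>b\<in>{b. t < \<phi> b}. {x \<in> topspace X. b < h x})" .
  then show "openin X {x \<in> topspace X. t < \<phi> (h x)}"
    using lsc_maps_openin[OF h] by auto
qed

lemma ennreal_SUP_below: "(SUP b\<in>insert 0 {..<u}. b) = (u::ennreal)"
proof (rule antisym)
  show "u \<le> (SUP b\<in>insert 0 {..<u}. b)"
  proof (rule dense_le)
    fix b assume "b < u"
    then show "b \<le> (SUP b\<in>insert 0 {..<u}. b)" by (intro SUP_upper2[of b]) auto
  qed
  show "(SUP b\<in>insert 0 {..<u}. b) \<le> u"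
    by (rule SUP_least) auto
qed

lemma lsc_maps_mult:
  assumes "h \<in> lsc_maps X"
  shows "(\<lambda>x\<in>topspace X. c * h x) \<in> lsc_maps X"
proof (rule lsc_maps_compose_from_below[OF assms])
  fix u :: ennreal
  show "c * u = (SUP b\<in>insert 0 {..<u}. c * b)"
    using SUP_mult_left_ennreal[of c "\<lambda>b. b" "insert 0 {..<u}"] unfolding ennreal_SUP_below .
qed

lemma lsc_maps_add_const:
  assumes "h \<in> lsc_maps X"
  shows "(\<lambda>x\<in>topspace X. c + h x) \<in> lsc_maps X"
proof (rule lsc_maps_compose_from_below[OF assms])
  fix u :: ennreal
  show "c + u = (SUP b\<in>insert 0 {..<u}. c + b)"
    using ennreal_SUP_add_right[of "insert 0 {..<u}" c "\<lambda>b. b"] unfolding ennreal_SUP_below by blast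
qed

text \<open>
  By continuity from below of addition in its first argument, \<open>h + g\<close> is the supremum over constants \<open>b\<close> of
  the functions equal to \<open>b + g\<close> where \<open>h > b\<close> and to \<open>g\<close> elsewhere.
\<close>
lemma lsc_maps_add:
  assumes h: "h \<in> lsc_maps X" and g: "g \<in> lsc_maps X"
  shows "(\<lambda>x\<in>topspace X. h x + g x) \<in> lsc_maps X"
proof -
  have eq: "h x + g x = (SUP b. (if b < h x then b + g x else g x))" for x
  proof -
    have "h x + g x = (SUP b\<in>insert 0 {..<h x}. b + g x)"
      using ennreal_SUP_add_left[of "insert 0 {..<h x}" "\<lambda>b. b" "g x"] unfolding ennreal_SUP_below by force
    also have "\<dots> = (SUP b. (if b < h x then b + g x else g x))"
    proof (rule antisym; rule SUP_least)
      fix b assume "b \<in> insert 0 {..<h x}"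
      then show "b + g x \<le> (SUP b. (if b < h x then b + g x else g x))"
        by (intro SUP_upper2[of b]) auto
    next
      fix b show "(if b < h x then b + g x else g x) \<le> (SUP b\<in>insert 0 {..<h x}. b + g x)"
        by (rule SUP_upper2[of "if b < h x then b else 0"]) auto
    qed
    finally show ?thesis .
  qed
  have "(\<lambda>x\<in>topspace X. if b < h x then b + g x else g x) \<in> lsc_maps X" for b
  proof (rule lsc_mapsI)
    fix t
    have "{x \<in> topspace X. t < (if b < h x then b + g x else g x)} =
       ({x \<in> topspace X. b < h x} \<inter> {x \<in> topspace X. t < (\<lambda>x\<in>topspace X. b + g x) x}) \<union> {x \<in> topspace X. t < g x}"
      by (auto elim: order_less_le_trans)
    then show "openin X {x \<in> topspace X. t < (if b < h x then b + g x else g x)}"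
      using lsc_maps_openin[OF h] lsc_maps_openin[OF g] lsc_maps_openin[OF lsc_maps_add_const[OF g]]
      by (simp only: openin_Int openin_Un)
  qed
  from lsc_maps_SUP[of UNIV, OF this] 
  have "(\<lambda>x\<in>topspace X. SUP b. (\<lambda>x\<in>topspace X. if b < h x then b + g x else g x) x) \<in> lsc_maps X" .
  also have "(\<lambda>x\<in>topspace X. SUP b. (\<lambda>x\<in>topspace X. if b < h x then b + g x else g x) x) = (\<lambda>x\<in>topspace X. h x + g x)"
    by (auto simp: restrict_def fun_eq_iff eq)
  finally show ?thesis .
qed

section \<open>Step functions\<close>

text \<open>
  The pointwise supremum of the functions equal to \<open>r m\<close> on \<open>U m\<close> and to \<open>0\<close> elsewhere. Suprema are used instead
  of sums because they make the function depend on each \<open>U m\<close> in a way that preserves directed unions.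
\<close>
definition step_function :: "'a topology \<Rightarrow> nat \<Rightarrow> (nat \<Rightarrow> ennreal) \<Rightarrow> (nat \<Rightarrow> 'a set) \<Rightarrow> 'a \<Rightarrow> ennreal" where
  "step_function X n r U = (\<lambda>x\<in>topspace X. SUP m\<in>{m. m < n \<and> x \<in> U m}. r m)"

lemma step_function_lsc:
  assumes "\<And>m. m < n \<Longrightarrow> openin X (U m)"
  shows "step_function X n r U \<in> lsc_maps X"
  unfolding step_function_def
proof (rule lsc_mapsI)
  fix t
  have "{x \<in> topspace X. t < (SUP m\<in>{m. m < n \<and> x \<in> U m}. r m)} = (\<Union>m\<in>{m. m < n \<and> t < r m}. U m)"
    using assms openin_subset by (fastforce simp: less_SUP_iff)
  then show "openin X {x \<in> topspace X. t < (SUP m\<in>{m. m < n \<and> x \<in> U m}. r m)}"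
    using assms by auto
qed

lemma step_function_le:
  assumes "x \<in> topspace X" "\<And>m. m < n \<Longrightarrow> x \<in> U m \<Longrightarrow> r m \<le> c"
  shows "step_function X n r U x \<le> c"
  using assms by (auto simp: step_function_def intro: SUP_least)

lemma step_function_ge:
  assumes "x \<in> topspace X" "m < n" "x \<in> U m"
  shows "r m \<le> step_function X n r U x"
  using assms by (auto simp: step_function_def intro: SUP_upper)

lemma step_function_cong:
  assumes "\<And>m x. m < n \<Longrightarrow> x \<in> topspace X \<Longrightarrow> x \<in> U m \<longleftrightarrow> x \<in> V m"
  shows "step_function X n r U = step_function X n r V"
  unfolding step_function_def using assms by (intro restrict_ext SUP_cong) auto

lemma step_function_mono:
  assumes "x \<in> topspace X" "\<And>m. m < n \<Longrightarrow> x \<in> U m \<Longrightarrow> x \<in> V m"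
  shows "step_function X n r U x \<le> step_function X n r V x"
  using assms by (intro step_function_le) (auto intro: step_function_ge)

section \<open>Previsions\<close>

lemma prevision_mono:
  assumes "prevision X F" "h \<in> lsc_maps X" "g \<in> lsc_maps X"
    and "\<And>x. x \<in> topspace X \<Longrightarrow> h x \<le> g x"
  shows "F h \<le> F g"
  using assms unfolding prevision_def scott_continuous_on_def mono_on_def
  by (simp add: lsc_maps_le_iff)

lemma prevision_SUP:
  assumes F: "prevision X F" and A: "A \<noteq> {}"
    and f: "\<And>i. i \<in> A \<Longrightarrow> f i \<in> lsc_maps X"
    and dir: "\<And>i j. i \<in> A \<Longrightarrow> j \<in> A \<Longrightarrow>
               \<exists>k\<in>A. \<forall>x\<in>topspace X. f i x \<le> f k x \<and> f j x \<le> f k x"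
  shows "F (\<lambda>x\<in>topspace X. SUP i\<in>A. f i x) = (SUP i\<in>A. F (f i))"
proof -
  have "directed_on (f ` A) (\<le>)"
    unfolding directed_on_def
  proof (intro conjI ballI)
    fix g h assume "g \<in> f ` A" "h \<in> f ` A"
    then obtain i j where ij: "i \<in> A" "j \<in> A" "g = f i" "h = f j" by auto
    then obtain k where "k \<in> A" "\<forall>x\<in>topspace X. f i x \<le> f k x \<and> f j x \<le> f k x" using dir by blast
    then show "\<exists>z\<in>f ` A. g \<le> z \<and> h \<le> z"
      using f ij by (metis imageI lsc_maps_le_iff)
  qed (use A in auto)
  moreover have "is_lub_in (lsc_maps X) (f ` A) (\<lambda>x\<in>topspace X. SUP i\<in>A. f i x)"
    using f by (subst is_lub_in_lsc_maps) (auto simp: image_image)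
  moreover have "f ` A \<subseteq> lsc_maps X" using f by auto
  ultimately have "is_lub_in UNIV (F ` f ` A) (F (\<lambda>x\<in>topspace X. SUP i\<in>A. f i x))"
    using F unfolding prevision_def scott_continuous_on_def by blast
  then have "F (\<lambda>x\<in>topspace X. SUP i\<in>A. f i x) = Sup (F ` f ` A)"
    unfolding is_lub_in_def by (metis Sup_least Sup_upper UNIV_I antisym)
  then show ?thesis by (simp add: image_image)
qed

lemma prevision_less_SUP:
  assumes F: "prevision X F" and A: "A \<noteq> {}"
    and f: "\<And>i. i \<in> A \<Longrightarrow> f i \<in> lsc_maps X"
    and dir: "\<And>i j. i \<in> A \<Longrightarrow> j \<in> A \<Longrightarrow>
               \<exists>k\<in>A. \<forall>x\<in>topspace X. f i x \<le> f k x \<and> f j x \<le> f k x"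
    and g: "g \<in> lsc_maps X" "t < F g" "\<And>x. x \<in> topspace X \<Longrightarrow> g x \<le> (SUP i\<in>A. f i x)"
  obtains i where "i \<in> A" "t < F (f i)"
proof -
  have "F g \<le> F (\<lambda>x\<in>topspace X. SUP i\<in>A. f i x)"
    using g f by (intro prevision_mono[OF F]) (auto intro: lsc_maps_SUP)
  also have "\<dots> = (SUP i\<in>A. F (f i))" by (rule prevision_SUP[OF F A f dir])
  finally show thesis using g(2) that by (metis less_SUP_iff order_less_le_trans)
qed

text \<open>
  The step functions with levels \<open>r m\<close> and sets \<open>{g > r m}\<close> are directed, by concatenation of the lists of
  levels, and a single level \<open>c\<close> already reaches \<open>c\<close> at every point where \<open>g\<close> exceeds \<open>c\<close>; so their supremum is \<open>g\<close>.
\<close>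
lemma prevision_step_function:
  assumes F: "prevision X F" and g: "g \<in> lsc_maps X" "t < F g"
  obtains n r where "t < F (step_function X n r (\<lambda>m. {x \<in> topspace X. r m < g x}))"
proof -
  let ?f = "\<lambda>(n, r). step_function X n r (\<lambda>m. {x \<in> topspace X. r m < g x})"
  have f: "?f nr \<in> lsc_maps X" for nr
    by (cases nr) (auto intro: step_function_lsc lsc_maps_openin g)
  have dir: "\<exists>k\<in>UNIV. \<forall>x\<in>topspace X. ?f i x \<le> ?f k x \<and> ?f j x \<le> ?f k x" for i j
  proof -
    obtain n r n' r' where ij: "i = (n, r)" "j = (n', r')" by (cases i, cases j) auto
    \<comment> \<open>the levels of \<open>i\<close> followed by those of \<open>j\<close>\<close>
    let ?r = "\<lambda>m. if m < n then r m else r' (m - n)"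
    let ?k = "(n + n', ?r)"
    have "?f i x \<le> ?f ?k x" if x: "x \<in> topspace X" for x
      unfolding ij prod.case
    proof (rule step_function_le[OF x])
      fix m assume "m < n" "x \<in> {x \<in> topspace X. r m < g x}"
      then show "r m \<le> step_function X (n + n') ?r (\<lambda>m. {x \<in> topspace X. ?r m < g x}) x"
        using step_function_ge[OF x, of m "n + n'" "\<lambda>m. {x \<in> topspace X. ?r m < g x}" ?r] by auto
    qed
    moreover have "?f j x \<le> ?f ?k x" if x: "x \<in> topspace X" for x
      unfolding ij prod.case
    proof (rule step_function_le[OF x])
      fix m assume "m < n'" "x \<in> {x \<in> topspace X. r' m < g x}"
      then show "r' m \<le> step_function X (n + n') ?r (\<lambda>m. {x \<in> topspace X. ?r m < g x}) x"
        using step_function_ge[OF x, of "n + m" "n + n'" "\<lambda>m. {x \<in> topspace X. ?r m < g x}" ?r] by auto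
    qed
    ultimately show ?thesis by blast
  qed
  have le: "g x \<le> (SUP i\<in>UNIV. ?f i x)" if x: "x \<in> topspace X" for x
  proof (rule dense_le)
    fix c assume c: "c < g x"
    have "c \<le> ?f (1, \<lambda>_. c) x"
      using step_function_ge[OF x, of 0 1 "\<lambda>m. {x \<in> topspace X. c < g x}" "\<lambda>_. c"] x c by auto
    also have "\<dots> \<le> (SUP i\<in>UNIV. ?f i x)" by (rule SUP_upper) simp
    finally show "c \<le> (SUP i\<in>UNIV. ?f i x)" .
  qed
  obtain i where "t < F (?f i)"
    using prevision_less_SUP[OF F _ f dir g le] by auto
  then show thesis using that by (cases i) auto
qed

lemma previsionI:
  assumes ext: "F \<in> extensional (lsc_maps X)"
    and mono: "\<And>h g. h \<in> lsc_maps X \<Longrightarrow> g \<in> lsc_maps X \<Longrightarrow> (\<And>x. x \<in> topspace X \<Longrightarrow> h x \<le> g x) \<Longrightarrow> F h \<le> F g"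
    and sup: "\<And>D. D \<subseteq> lsc_maps X \<Longrightarrow> D \<noteq> {} \<Longrightarrow>
        (\<And>c d. c \<in> D \<Longrightarrow> d \<in> D \<Longrightarrow> \<exists>e\<in>D. \<forall>x\<in>topspace X. c x \<le> e x \<and> d x \<le> e x) \<Longrightarrow>
        F (\<lambda>x\<in>topspace X. SUP d\<in>D. d x) \<le> (SUP d\<in>D. F d)"
    and hom: "\<And>a h. h \<in> lsc_maps X \<Longrightarrow> 0 \<le> (a::real) \<Longrightarrow> F (\<lambda>x\<in>topspace X. ennreal a * h x) = ennreal a * F h"
  shows "prevision X F"
proof -
  have "is_lub_in UNIV (F ` D) (F s)"
    if D: "D \<subseteq> lsc_maps X" and dir: "directed_on D (\<le>)" and lub: "is_lub_in (lsc_maps X) D s" for D s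
  proof -
    have s: "s = (\<lambda>x\<in>topspace X. SUP h\<in>D. h x)" using is_lub_in_lsc_maps[OF D] lub by blast
    have le: "F s \<le> (SUP d\<in>D. F d)"
      unfolding s
    proof (rule sup[OF D])
      show "D \<noteq> {}" using dir by (simp add: directed_on_def)
      fix c d assume "c \<in> D" "d \<in> D"
      then show "\<exists>e\<in>D. \<forall>x\<in>topspace X. c x \<le> e x \<and> d x \<le> e x"
        using dir unfolding directed_on_def le_fun_def by blast
    qed
    have "F d \<le> F s" if "d \<in> D" for d
    proof (rule mono)
      show "d \<in> lsc_maps X" using that D by blast
      show "s \<in> lsc_maps X" using lub by (simp add: is_lub_in_def)
      show "d x \<le> s x" if "x \<in> topspace X" for x
        using that \<open>d \<in> D\<close> by (auto simp: s intro: SUP_upper)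
    qed
    then show ?thesis
      unfolding is_lub_in_def using order_trans[OF le SUP_least] by auto
  qed
  moreover have "mono_on (lsc_maps X) F"
    by (rule mono_onI, rule mono) (auto simp: le_fun_def)
  ultimately show ?thesis
    unfolding prevision_def scott_continuous_on_def using ext hom by blast
qed

lemma prevision_mult:
  assumes "prevision X F" "h \<in> lsc_maps X" "0 \<le> a"
  shows "F (\<lambda>x\<in>topspace X. ennreal a * h x) = ennreal a * F h"
  using assms by (simp add: prevision_def)

lemma lsc_maps_const: "(\<lambda>x\<in>topspace X. c) \<in> lsc_maps X"
  by (rule lsc_mapsI) (case_tac "t < c", auto)

lemma prevision_zero:
  assumes "prevision X F"
  shows "F (\<lambda>x\<in>topspace X. 0) = 0"
  using prevision_mult[OF assms lsc_maps_const, of 0 0] by (simp add: restrict_def cong: if_cong)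

section \<open>Spaces of previsions\<close>

lemma AP_map_preserves:
  assumes f: "continuous_map X Y f" and F: "F \<in> AP_previsions b X"
  shows "AP_map X Y f F \<in> AP_previsions b Y"
proof -
  let ?p = "\<lambda>h. \<lambda>x\<in>topspace X. h (f x)"
  have fx: "f x \<in> topspace Y" if "x \<in> topspace X" for x
    using f that by (auto simp: continuous_map_def)
  have p: "?p h \<in> lsc_maps X" if "h \<in> lsc_maps Y" for h by (rule lsc_maps_pullback[OF f that])
  have pr: "prevision X F" and sub: "sublinear_on X F" and nor: "satisfies_normality b X F"
    using F by (auto simp: AP_previsions_def)
  have pp: "?p (\<lambda>y\<in>topspace Y. \<phi> y) = (\<lambda>x\<in>topspace X. \<phi> (f x))" for \<phi> :: "'b \<Rightarrow> ennreal"
    using fx by (auto simp: fun_eq_iff restrict_def)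
  have "prevision Y (AP_map X Y f F)"
  proof (rule previsionI)
    fix h g assume hg: "h \<in> lsc_maps Y" "g \<in> lsc_maps Y" "\<And>x. x \<in> topspace Y \<Longrightarrow> h x \<le> g x"
    then show "AP_map X Y f F h \<le> AP_map X Y f F g"
      using fx by (auto simp: AP_map_def intro!: prevision_mono[OF pr] p)
  next
    fix D assume D: "D \<subseteq> lsc_maps Y" "D \<noteq> {}"
      "\<And>c d. c \<in> D \<Longrightarrow> d \<in> D \<Longrightarrow> \<exists>e\<in>D. \<forall>x\<in>topspace Y. c x \<le> e x \<and> d x \<le> e x"
    let ?s = "\<lambda>y\<in>topspace Y. SUP d\<in>D. d y"
    have s: "?s \<in> lsc_maps Y" using D(1) by (intro lsc_maps_SUP) auto
    have "F (?p ?s) = F (\<lambda>x\<in>topspace X. SUP d\<in>D. ?p d x)"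
      unfolding pp by (intro arg_cong[of _ _ F] restrict_ext) simp
    also have "\<dots> = (SUP d\<in>D. F (?p d))"
    proof (rule prevision_SUP[OF pr D(2)])
      show "?p d \<in> lsc_maps X" if "d \<in> D" for d using p that D(1) by blast
      fix c d assume "c \<in> D" "d \<in> D"
      from D(3)[OF this] obtain e where "e \<in> D" "\<forall>x\<in>topspace Y. c x \<le> e x \<and> d x \<le> e x" by blast
      then show "\<exists>e\<in>D. \<forall>x\<in>topspace X. ?p c x \<le> ?p e x \<and> ?p d x \<le> ?p e x"
        using fx by (intro bexI[of _ e]) auto
    qed
    also have "\<dots> = (SUP d\<in>D. AP_map X Y f F d)"
      using D(1) by (intro SUP_cong) (auto simp: AP_map_def)
    finally show "AP_map X Y f F ?s \<le> (SUP d\<in>D. AP_map X Y f F d)"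
      using s by (simp add: AP_map_def)
  next
    fix a :: real and h assume h: "h \<in> lsc_maps Y" "0 \<le> a"
    have "F (?p (\<lambda>y\<in>topspace Y. ennreal a * h y)) = F (\<lambda>x\<in>topspace X. ennreal a * ?p h x)"
      unfolding pp by (intro arg_cong[of _ _ F] restrict_ext) simp
    then show "AP_map X Y f F (\<lambda>y\<in>topspace Y. ennreal a * h y) = ennreal a * AP_map X Y f F h"
      using h prevision_mult[OF pr p] by (simp add: AP_map_def lsc_maps_mult)
  qed (simp add: AP_map_def)
  moreover have "sublinear_on Y (AP_map X Y f F)"
    unfolding sublinear_on_def
  proof (intro ballI)
    fix h h' assume h: "h \<in> lsc_maps Y" "h' \<in> lsc_maps Y"
    have "F (?p (\<lambda>y\<in>topspace Y. h y + h' y)) = F (\<lambda>x\<in>topspace X. ?p h x + ?p h' x)"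
      unfolding pp by (intro arg_cong[of _ _ F] restrict_ext) simp
    also have "\<dots> \<le> F (?p h) + F (?p h')"
      using sub p h unfolding sublinear_on_def by blast
    finally show "AP_map X Y f F (\<lambda>y\<in>topspace Y. h y + h' y) \<le> AP_map X Y f F h + AP_map X Y f F h'"
      using h by (simp add: AP_map_def lsc_maps_add)
  qed
  moreover have "satisfies_normality b Y (AP_map X Y f F)"
  proof -
    have "F (?p (\<lambda>y\<in>topspace Y. 1 + h y)) = F (\<lambda>x\<in>topspace X. 1 + ?p h x)" for h
      unfolding pp by (intro arg_cong[of _ _ F] restrict_ext) simp
    then have eq: "AP_map X Y f F (\<lambda>y\<in>topspace Y. 1 + h y) = F (\<lambda>x\<in>topspace X. 1 + ?p h x)"
      if "h \<in> lsc_maps Y" for h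
      using that by (simp add: AP_map_def lsc_maps_add_const)
    have eq': "AP_map X Y f F h = F (?p h)" if "h \<in> lsc_maps Y" for h
      using that by (simp add: AP_map_def)
    have "subnormalized_on Y (AP_map X Y f F)" if "subnormalized_on X F"
      unfolding subnormalized_on_def
    proof
      fix h assume h: "h \<in> lsc_maps Y"
      show "AP_map X Y f F (\<lambda>y\<in>topspace Y. 1 + h y) \<le> 1 + AP_map X Y f F h"
        unfolding eq[OF h] eq'[OF h] using that p[OF h] unfolding subnormalized_on_def by blast
    qed
    moreover have "normalized_on Y (AP_map X Y f F)" if "normalized_on X F"
      unfolding normalized_on_def
    proof
      fix h assume h: "h \<in> lsc_maps Y"
      show "AP_map X Y f F (\<lambda>y\<in>topspace Y. 1 + h y) = 1 + AP_map X Y f F h"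
        unfolding eq[OF h] eq'[OF h] using that p[OF h] unfolding normalized_on_def by blast
    qed
    ultimately show ?thesis using nor by (cases b) auto
  qed
  ultimately show ?thesis by (simp add: AP_previsions_def)
qed

lemma topspace_AP_space: "topspace (AP_space b X) = AP_previsions b X"
  unfolding AP_space_def by auto

lemma openin_AP_space:
  assumes "h \<in> lsc_maps X" "0 \<le> r"
  shows "openin (AP_space b X) {F \<in> AP_previsions b X. ennreal r < F h}"
  unfolding AP_space_def using assms by (intro topology_generated_by_Basis) auto

text \<open>
  It suffices to check the subbasic sets; the whole carrier, also a generator, has the whole space as preimage.
\<close>
lemma continuous_map_into_AP_space:
  assumes "f ` topspace Z \<subseteq> AP_previsions b X"
    and "\<And>h r. h \<in> lsc_maps X \<Longrightarrow> 0 \<le> r \<Longrightarrow> openin Z {z \<in> topspace Z. ennreal r < f z h}"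
  shows "continuous_map Z (AP_space b X) f"
  unfolding AP_space_def
proof (rule continuous_on_generated_topo)
  show "f ` topspace Z \<subseteq> \<Union> (insert (AP_previsions b X)
          {{F \<in> AP_previsions b X. ennreal r < F h} | h r. h \<in> lsc_maps X \<and> 0 \<le> (r::real)})"
    using assms(1) by blast
  fix U assume "U \<in> insert (AP_previsions b X)
          {{F \<in> AP_previsions b X. ennreal r < F h} | h r. h \<in> lsc_maps X \<and> 0 \<le> (r::real)}"
  then consider "U = AP_previsions b X"
    | h r where "h \<in> lsc_maps X" "0 \<le> r" "U = {F \<in> AP_previsions b X. ennreal r < F h}" by blast
  then show "openin Z (f -` U \<inter> topspace Z)"
  proof cases
    case 1
    then have "f -` U \<inter> topspace Z = topspace Z" using assms(1) by blast
    then show ?thesis by simp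
  next
    case 2
    then have "f -` U \<inter> topspace Z = {z \<in> topspace Z. ennreal r < f z h}" using assms(1) by blast
    then show ?thesis using assms(2) 2 by simp
  qed
qed

lemma continuous_AP_map:
  assumes f: "continuous_map X Y f"
  shows "continuous_map (AP_space b X) (AP_space b Y) (AP_map X Y f)"
proof (rule continuous_map_into_AP_space)
  show "AP_map X Y f ` topspace (AP_space b X) \<subseteq> AP_previsions b Y"
    using AP_map_preserves[OF f] by (auto simp: topspace_AP_space)
  fix h :: "'b \<Rightarrow> ennreal" and r :: real assume h: "h \<in> lsc_maps Y" "0 \<le> r"
  then show "openin (AP_space b X) {F \<in> topspace (AP_space b X). ennreal r < AP_map X Y f F h}"
    using openin_AP_space[OF lsc_maps_pullback[OF f h(1)] h(2)] by (simp add: topspace_AP_space AP_map_def)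
qed

lemma AP_map_id:
  assumes "F \<in> AP_previsions b X" "\<And>x. x \<in> topspace X \<Longrightarrow> f x = x"
  shows "AP_map X X f F = F"
proof
  fix h
  show "AP_map X X f F h = F h"
  proof (cases "h \<in> lsc_maps X")
    case True
    then have "(\<lambda>x\<in>topspace X. h (f x)) = h"
      using assms(2) lsc_maps_restrict[OF True] by (metis (no_types, lifting) restrict_ext)
    then show ?thesis using True by (simp add: AP_map_def)
  next
    case False
    then show ?thesis using assms(1) by (simp add: AP_map_def AP_previsions_def prevision_def extensional_def)
  qed
qed

lemma AP_map_comp:
  assumes f: "continuous_map X Y f" and g: "continuous_map Y Z g"
    and k: "\<And>x. x \<in> topspace X \<Longrightarrow> g (f x) = k x"
  shows "AP_map Y Z g (AP_map X Y f F) = AP_map X Z k F"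
proof
  fix h :: "'c \<Rightarrow> ennreal"
  have "(\<lambda>x\<in>topspace X. (\<lambda>y\<in>topspace Y. h (g y)) (f x)) = (\<lambda>x\<in>topspace X. h (k x))"
    using f k by (auto simp: fun_eq_iff restrict_def continuous_map_def)
  then show "AP_map Y Z g (AP_map X Y f F) h = AP_map X Z k F h"
    using lsc_maps_pullback[OF g, of h] by (simp add: AP_map_def)
qed

section \<open>Inverse systems of compact sets in sober spaces\<close>

lemma closed_chain_meets_compact:
  assumes K: "compactin X K" and ne: "\<C> \<noteq> {}"
    and cl: "\<And>C. C \<in> \<C> \<Longrightarrow> closedin X C \<and> C \<inter> K \<noteq> {}"
    and dir: "\<And>C D. C \<in> \<C> \<Longrightarrow> D \<in> \<C> \<Longrightarrow> \<exists>E\<in>\<C>. E \<subseteq> C \<and> E \<subseteq> D"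
  shows "\<Inter>\<C> \<inter> K \<noteq> {}"
proof -
  have fin: "\<exists>E\<in>\<C>. E \<subseteq> \<Inter>\<F>" if "finite \<F>" "\<F> \<subseteq> \<C>" for \<F>
    using that
  proof (induction rule: finite_induct)
    case empty
    then show ?case using ne by auto
  next
    case (insert C \<F>)
    then obtain D where "D \<in> \<C>" "D \<subseteq> \<Inter>\<F>" by auto
    moreover obtain E where "E \<in> \<C>" "E \<subseteq> C" "E \<subseteq> D"
      using dir[of C D] insert.prems \<open>D \<in> \<C>\<close> by auto
    ultimately show ?case by (intro bexI[of _ E]) auto
  qed
  have "K \<inter> \<Inter>\<F> \<noteq> {}" if "finite \<F>" "\<F> \<subseteq> \<C>" for \<F>
    using fin[OF that] cl by blast
  then have "K \<inter> \<Inter>\<C> \<noteq> {}"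
    using cl by (intro K[unfolded compactin_fip, THEN conjunct2, rule_format]) simp
  then show ?thesis by (simp add: Int_commute)
qed

locale inverse_system =
  fixes I :: "'i set" and le :: "'i \<Rightarrow> 'i \<Rightarrow> bool"
    and X :: "'i \<Rightarrow> 'a topology" and p :: "'i \<Rightarrow> 'i \<Rightarrow> 'a \<Rightarrow> 'a"
  assumes system: "projective_system I le X p"
begin

lemma le_refl: "i \<in> I \<Longrightarrow> le i i"
  using system by (auto simp: projective_system_def reflp_on_def)

lemma le_trans: "le i j \<Longrightarrow> le j k \<Longrightarrow> i \<in> I \<Longrightarrow> j \<in> I \<Longrightarrow> k \<in> I \<Longrightarrow> le i k"
  using system unfolding projective_system_def transp_on_def by blast

lemma nonempty: "I \<noteq> {}"
  using system by (auto simp: projective_system_def directed_on_def)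

lemma directed: "i \<in> I \<Longrightarrow> j \<in> I \<Longrightarrow> \<exists>k\<in>I. le i k \<and> le j k"
  using system by (auto simp: projective_system_def directed_on_def)

lemma continuous_p: "i \<in> I \<Longrightarrow> j \<in> I \<Longrightarrow> le i j \<Longrightarrow> continuous_map (X j) (X i) (p i j)"
  using system by (auto simp: projective_system_def)

lemma p_in: "i \<in> I \<Longrightarrow> j \<in> I \<Longrightarrow> le i j \<Longrightarrow> x \<in> topspace (X j) \<Longrightarrow> p i j x \<in> topspace (X i)"
  using continuous_p[of i j] by (auto simp: continuous_map_def)

lemma p_id: "i \<in> I \<Longrightarrow> x \<in> topspace (X i) \<Longrightarrow> p i i x = x"
  using system by (auto simp: projective_system_def)

lemma p_p: "i \<in> I \<Longrightarrow> j \<in> I \<Longrightarrow> k \<in> I \<Longrightarrow> le i j \<Longrightarrow> le j k \<Longrightarrow> x \<in> topspace (X k) \<Longrightarrow> p i j (p j k x) = p i k x"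
  using system unfolding projective_system_def by blast

text \<open>
  The closed families that a failure of the compactness theorem would leave behind: if no \<open>K i\<close> is contained in
  \<open>W i\<close>, then the complements of the \<open>W i\<close> are such a family.
\<close>
definition critical :: "('i \<Rightarrow> 'a set) \<Rightarrow> ('i \<Rightarrow> 'a set) \<Rightarrow> bool" where
  "critical K C \<longleftrightarrow>
     (\<forall>i\<in>I. closedin (X i) (C i) \<and> C i \<inter> K i \<noteq> {}) \<and>
     (\<forall>i\<in>I. \<forall>j\<in>I. le i j \<longrightarrow> p i j ` C j \<subseteq> C i)"

definition minimal_critical :: "('i \<Rightarrow> 'a set) \<Rightarrow> ('i \<Rightarrow> 'a set) \<Rightarrow> bool" where
  "minimal_critical K M \<longleftrightarrow> critical K M \<and>
     (\<forall>N. critical K N \<and> (\<forall>i\<in>I. N i \<subseteq> M i) \<longrightarrow> (\<forall>i\<in>I. N i = M i))"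

text \<open>
  Zorn's lemma, since an intersection of a chain of closed sets that all meet a compact set still meets it. The
  order is reversed by passing to complements inside \<open>C\<close>, and a family is coded by the set of its pairs
  of an index and an element, so that the order on families is inclusion.
\<close>
lemma minimal_critical_exists:
  assumes K: "\<And>i. i \<in> I \<Longrightarrow> compactin (X i) (K i)" and C: "critical K C"
  obtains M where "minimal_critical K M" "\<And>i. i \<in> I \<Longrightarrow> M i \<subseteq> C i"
proof -
  define A where "A = {D. critical K (\<lambda>i. C i - D i) \<and> (\<forall>i. D i \<subseteq> C i) \<and> (\<forall>i. i \<notin> I \<longrightarrow> D i = {})}"
  have A_iff: "D \<in> A \<longleftrightarrow>
      critical K (\<lambda>i. C i - D i) \<and> (\<forall>i. D i \<subseteq> C i) \<and> (\<forall>i. i \<notin> I \<longrightarrow> D i = {})" for D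
    by (simp add: A_def)
  let ?code = "\<lambda>D :: 'i \<Rightarrow> 'a set. Sigma UNIV D"
  have "\<exists>M\<in>?code ` A. \<forall>Z\<in>?code ` A. M \<subseteq> Z \<longrightarrow> Z = M"
  proof (rule subset_Zorn_nonempty)
    have "(\<lambda>_. {}) \<in> A" using C by (simp add: A_iff)
    then show "?code ` A \<noteq> {}" by blast
  next
    fix \<D> assume ne: "\<D> \<noteq> {}" and "subset.chain (?code ` A) \<D>"
    then have sub: "\<D> \<subseteq> ?code ` A" and chain: "\<And>D E. D \<in> \<D> \<Longrightarrow> E \<in> \<D> \<Longrightarrow> D \<subseteq> E \<or> E \<subseteq> D"
      unfolding subset_chain_def by blast+
    let ?s = "\<lambda>D i. {x. (i, x) \<in> D}"
    let ?U = "\<lambda>i. \<Union>D\<in>\<D>. ?s D i"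
    have s: "?s D \<in> A" if D: "D \<in> \<D>" for D
    proof -
      obtain E where E: "E \<in> A" "D = ?code E" using D sub by blast
      then have "?s D = E" by auto
      with E show ?thesis by simp
    qed
    have crit: "critical K (\<lambda>i. C i - ?s D i)" if "D \<in> \<D>" for D using s[OF that] by (simp add: A_iff)
    have "critical K (\<lambda>i. C i - ?U i)"
      unfolding critical_def
    proof (intro conjI ballI impI)
      fix i assume i: "i \<in> I"
      have eq: "C i - ?U i = \<Inter>((\<lambda>D. C i - ?s D i) ` \<D>)" using ne by auto
      have cl: "closedin (X i) (C i - ?s D i) \<and> (C i - ?s D i) \<inter> K i \<noteq> {}" if "D \<in> \<D>" for D
        using crit[OF that] i unfolding critical_def by blast
      show "closedin (X i) (C i - ?U i)"
        unfolding eq using cl ne by (intro closedin_Inter) auto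
      show "(C i - ?U i) \<inter> K i \<noteq> {}"
        unfolding eq
      proof (rule closed_chain_meets_compact[OF K[OF i]])
        show "(\<lambda>D. C i - ?s D i) ` \<D> \<noteq> {}" using ne by simp
        show "\<And>E. E \<in> (\<lambda>D. C i - ?s D i) ` \<D> \<Longrightarrow> closedin (X i) E \<and> E \<inter> K i \<noteq> {}"
          using cl by blast
        fix E E' assume "E \<in> (\<lambda>D. C i - ?s D i) ` \<D>" "E' \<in> (\<lambda>D. C i - ?s D i) ` \<D>"
        then obtain D D' where D: "D \<in> \<D>" "D' \<in> \<D>" "E = C i - ?s D i" "E' = C i - ?s D' i" by blast
        from chain[OF D(1,2)] have "E \<subseteq> E' \<or> E' \<subseteq> E" unfolding D by blast
        then show "\<exists>E''\<in>(\<lambda>D. C i - ?s D i) ` \<D>. E'' \<subseteq> E \<and> E'' \<subseteq> E'" using D by blast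
      qed
    next
      fix i j assume ij: "i \<in> I" "j \<in> I" "le i j"
      have "p i j ` (C j - ?s D j) \<subseteq> C i - ?s D i" if "D \<in> \<D>" for D
        using crit[OF that] ij unfolding critical_def by blast
      then show "p i j ` (C j - ?U j) \<subseteq> C i - ?U i"
        using ne by blast
    qed
    moreover have "?U i \<subseteq> C i" for i using s unfolding A_iff by blast
    moreover have "?U i = {}" if "i \<notin> I" for i using s that unfolding A_iff by blast
    ultimately have "?U \<in> A" by (simp only: A_iff) blast
    moreover have "\<Union>\<D> = ?code ?U" by auto
    ultimately show "\<Union>\<D> \<in> ?code ` A" by blast
  qed
  then obtain Z where Z: "Z \<in> ?code ` A" and Zmax: "\<forall>Z'\<in>?code ` A. Z \<subseteq> Z' \<longrightarrow> Z' = Z" ..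
  from Z obtain D where D: "D \<in> A" and "Z = ?code D" by (rule imageE)
  with Zmax have max: "?code E = ?code D" if "E \<in> A" "?code D \<subseteq> ?code E" for E
    using that by (metis imageI)
  have "N i = C i - D i"
    if N: "critical K N" "\<And>i. i \<in> I \<Longrightarrow> N i \<subseteq> C i - D i" and i: "i \<in> I" for N i
  proof -
    let ?E = "\<lambda>i. if i \<in> I then C i - N i else {}"
    have "critical K (\<lambda>i. C i - ?E i)"
    proof -
      have "C i - ?E i = N i" if "i \<in> I" for i using N(2)[OF that] that by auto
      then show ?thesis using N(1) unfolding critical_def by simp
    qed
    then have "?E \<in> A" by (simp only: A_iff) simp
    moreover have "D i \<subseteq> ?E i" for i using D N(2)[of i] unfolding A_iff by auto
    then have "?code D \<subseteq> ?code ?E" by blast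
    ultimately have "?code ?E = ?code D" using max by blast
    then have "?E i = D i" by blast
    then show ?thesis using N(2)[OF i] i by auto
  qed
  moreover have "critical K (\<lambda>i. C i - D i)" using D by (simp add: A_iff)
  ultimately have "minimal_critical K (\<lambda>i. C i - D i)"
    unfolding minimal_critical_def by blast
  then show thesis using that by blast
qed

text \<open>
  Shrinking a critical family \<open>M\<close> at one index \<open>j\<close> to a closed set \<open>A\<close> that still meets what comes from \<open>K\<close>
  forces it to shrink everywhere: at \<open>i\<close> the new member is the intersection, over all \<open>k\<close> above \<open>i\<close> and \<open>j\<close>, of the
  closed images of the part of \<open>M k\<close> over \<open>A\<close>. The result is critical again, so a minimal \<open>M\<close> must be equal to it.
  With \<open>A\<close> the whole space this says that the bonding maps have dense image between the members of \<open>M\<close>.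
\<close>
lemma critical_restrict:
  assumes K: "\<And>i. i \<in> I \<Longrightarrow> compactin (X i) (K i)"
    and pK: "\<And>i j. i \<in> I \<Longrightarrow> j \<in> I \<Longrightarrow> le i j \<Longrightarrow> p i j ` K j \<subseteq> K i"
    and min: "minimal_critical K M"
    and j: "j \<in> I" and A: "closedin (X j) A"
    and meet: "\<And>k. k \<in> I \<Longrightarrow> le j k \<Longrightarrow> \<exists>x\<in>M k \<inter> K k. p j k x \<in> A"
    and i: "i \<in> I" "k \<in> I" "le i k" "le j k"
  shows "M i \<subseteq> X i closure_of (p i k ` {x \<in> M k. p j k x \<in> A})"
proof -
  have M: "critical K M" using min by (simp add: minimal_critical_def)
  define B where "B = (\<lambda>i k. X i closure_of (p i k ` {x \<in> M k. p j k x \<in> A}))"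
  define N where "N = (\<lambda>i. \<Inter>k\<in>{k\<in>I. le i k \<and> le j k}. B i k)"
  have Mtop: "M i \<subseteq> topspace (X i)" if "i \<in> I" for i
    using M that unfolding critical_def by (metis closedin_subset)
  have pM: "p i k ` M k \<subseteq> M i" if "i \<in> I" "k \<in> I" "le i k" for i k
    using M that unfolding critical_def by blast
  have mono: "B i l \<subseteq> B i k" if "i \<in> I" "k \<in> I" "l \<in> I" "le i k" "le j k" "le k l" for i k l
    unfolding B_def
  proof (rule closure_of_mono, rule image_subsetI)
    fix x assume x: "x \<in> {x \<in> M l. p j l x \<in> A}"
    then have "x \<in> topspace (X l)" using Mtop that by blast
    then have "p i l x = p i k (p k l x)" "p j k (p k l x) = p j l x"
      using that j p_p by metis+
    moreover have "p k l x \<in> M k" using x pM[of k l] that by blast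
    ultimately show "p i l x \<in> p i k ` {x \<in> M k. p j k x \<in> A}" using x by auto
  qed
  have "critical K N"
    unfolding critical_def
  proof (intro conjI ballI impI)
    fix i assume i: "i \<in> I"
    obtain k0 where k0: "k0 \<in> I" "le i k0" "le j k0" using directed[OF i j] by blast
    then have ne: "{k\<in>I. le i k \<and> le j k} \<noteq> {}" by blast
    show "closedin (X i) (N i)"
      unfolding N_def B_def using ne by (intro closedin_Inter) auto
    show "N i \<inter> K i \<noteq> {}"
      unfolding N_def
    proof (rule closed_chain_meets_compact[OF K[OF i]])
      show "B i ` {k\<in>I. le i k \<and> le j k} \<noteq> {}" using ne by simp
    next
      fix C assume "C \<in> B i ` {k\<in>I. le i k \<and> le j k}"
      then obtain k where k: "k \<in> I" "le i k" "le j k" "C = B i k" by blast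
      then obtain x where x: "x \<in> M k" "x \<in> K k" "p j k x \<in> A" using meet by blast
      have "p i k ` {x \<in> M k. p j k x \<in> A} \<subseteq> topspace (X i)"
        using Mtop[OF i] pM[OF i, of k] k by blast
      then have "p i k x \<in> C"
        unfolding k B_def using x closure_of_subset by fast
      moreover have "p i k x \<in> K i" using pK[OF i, of k] k x by blast
      ultimately show "closedin (X i) C \<and> C \<inter> K i \<noteq> {}"
        unfolding k B_def by auto
    next
      fix C D assume "C \<in> B i ` {k\<in>I. le i k \<and> le j k}" "D \<in> B i ` {k\<in>I. le i k \<and> le j k}"
      then obtain k l where kl: "k \<in> I" "le i k" "le j k" "l \<in> I" "le i l" "le j l"
        and CD: "C = B i k" "D = B i l" by blast
      obtain m where m: "m \<in> I" "le k m" "le l m" using directed kl by blast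
      have "B i m \<subseteq> C" "B i m \<subseteq> D" unfolding CD using mono i kl m by blast+
      moreover have "le i m" "le j m" using le_trans i j kl m by blast+
      ultimately show "\<exists>E\<in>B i ` {k\<in>I. le i k \<and> le j k}. E \<subseteq> C \<and> E \<subseteq> D" using m by blast
    qed
  next
    fix i i' assume i: "i \<in> I" "i' \<in> I" "le i i'"
    show "p i i' ` N i' \<subseteq> N i"
    proof (rule image_subsetI)
      fix x assume x: "x \<in> N i'"
      show "p i i' x \<in> N i"
        unfolding N_def
      proof (rule INT_I)
        fix k assume "k \<in> {k\<in>I. le i k \<and> le j k}"
        then have k: "k \<in> I" "le i k" "le j k" by auto
        obtain l where l: "l \<in> I" "le i' l" "le k l" using directed i k by blast
        have jl: "le j l" using le_trans j k l by blast
        have "x \<in> B i' l" using x l jl unfolding N_def by blast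
        then have "p i i' x \<in> p i i' ` (X i' closure_of (p i' l ` {x \<in> M l. p j l x \<in> A}))"
          unfolding B_def by blast
        also have "\<dots> \<subseteq> X i closure_of (p i i' ` p i' l ` {x \<in> M l. p j l x \<in> A})"
          using continuous_map_image_closure_subset[OF continuous_p[OF i]] .
        also have "p i i' ` p i' l ` {x \<in> M l. p j l x \<in> A} = p i l ` {x \<in> M l. p j l x \<in> A}"
          unfolding image_image using Mtop[OF l(1)] i l p_p by (intro image_cong refl) auto
        also have "X i closure_of \<dots> = B i l" by (simp add: B_def)
        also have "\<dots> \<subseteq> B i k" using mono i k l by blast
        finally show "p i i' x \<in> B i k" .
      qed
    qed
  qed
  moreover have "N i \<subseteq> M i" if i: "i \<in> I" for i
  proof -
    obtain k where k: "k \<in> I" "le i k" "le j k" using directed[OF i j] by blast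
    have "N i \<subseteq> B i k" unfolding N_def using k by blast
    also have "\<dots> \<subseteq> M i"
      unfolding B_def
    proof (rule closure_of_minimal)
      show "p i k ` {x \<in> M k. p j k x \<in> A} \<subseteq> M i" using pM[OF i k(1,2)] by blast
      show "closedin (X i) (M i)" using M i unfolding critical_def by blast
    qed
    finally show ?thesis .
  qed
  ultimately have "N i = M i" using min i(1) unfolding minimal_critical_def by blast
  moreover have "N i \<subseteq> B i k" using i unfolding N_def by blast
  ultimately show ?thesis unfolding B_def by simp
qed

text \<open>
  Otherwise there is a minimal critical family \<open>M\<close> avoiding the \<open>W i\<close>. Minimality makes each \<open>M j\<close> irreducible:
  if it were covered by two smaller closed sets, the members above \<open>j\<close> could be restricted to the preimage of
  one of them. By sobriety \<open>M j\<close> is the closure of a unique point, these generic points form a thread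
  because the bonding maps have dense image, and they lie in the \<open>K j\<close> because \<open>K j\<close> is saturated. This thread misses
  every \<open>W i\<close>.
\<close>
lemma compact_family_inside_open:
  assumes sober: "\<And>i. i \<in> I \<Longrightarrow> sober_space (X i)"
    and K: "\<And>i. i \<in> I \<Longrightarrow> compactin (X i) (K i)" "\<And>i. i \<in> I \<Longrightarrow> saturated_in (X i) (K i)"
    and pK: "\<And>i j. i \<in> I \<Longrightarrow> j \<in> I \<Longrightarrow> le i j \<Longrightarrow> p i j ` K j \<subseteq> K i"
    and W: "\<And>i. i \<in> I \<Longrightarrow> openin (X i) (W i)"
    and pW: "\<And>i j x. i \<in> I \<Longrightarrow> j \<in> I \<Longrightarrow> le i j \<Longrightarrow> x \<in> topspace (X j) \<Longrightarrow> p i j x \<in> W i \<Longrightarrow> x \<in> W j"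
    and lim: "\<And>x. (\<forall>i\<in>I. x i \<in> K i) \<Longrightarrow> (\<forall>i\<in>I. \<forall>j\<in>I. le i j \<longrightarrow> p i j (x j) = x i) \<Longrightarrow> \<exists>i\<in>I. x i \<in> W i"
  shows "\<exists>i\<in>I. K i \<subseteq> W i"
proof (rule ccontr)
  assume no: "\<not> (\<exists>i\<in>I. K i \<subseteq> W i)"
  have "critical K (\<lambda>i. topspace (X i) - W i)"
    unfolding critical_def
  proof (intro conjI ballI impI)
    fix i assume i: "i \<in> I"
    show "closedin (X i) (topspace (X i) - W i)" using W[OF i] by blast
    show "(topspace (X i) - W i) \<inter> K i \<noteq> {}"
      using no i compactin_subset_topspace[OF K(1)[OF i]] by blast
  next
    fix i j assume "i \<in> I" "j \<in> I" "le i j"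
    then show "p i j ` (topspace (X j) - W j) \<subseteq> topspace (X i) - W i"
      using pW p_in by blast
  qed
  from minimal_critical_exists[OF K(1) this] obtain M where min: "minimal_critical K M"
    and MW: "\<And>i. i \<in> I \<Longrightarrow> M i \<subseteq> topspace (X i) - W i"
    by blast
  have M: "critical K M" using min by (simp add: minimal_critical_def)
  have Mcl: "closedin (X i) (M i)" "M i \<inter> K i \<noteq> {}" if "i \<in> I" for i
    using M that unfolding critical_def by blast+
  have Mtop: "M i \<subseteq> topspace (X i)" if "i \<in> I" for i
    using Mcl(1)[OF that] by (rule closedin_subset)
  have pM: "p i k ` M k \<subseteq> M i" if "i \<in> I" "k \<in> I" "le i k" for i k
    using M that unfolding critical_def by blast
  have dense: "M i \<subseteq> X i closure_of (p i k ` M k)" if ik: "i \<in> I" "k \<in> I" "le i k" for i k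
  proof -
    have "M i \<subseteq> X i closure_of (p i k ` {x \<in> M k. p i k x \<in> topspace (X i)})"
    proof (rule critical_restrict[where K = K])
      show "closedin (X i) (topspace (X i))" by simp
      fix l assume l: "l \<in> I" "le i l"
      then show "\<exists>x\<in>M l \<inter> K l. p i l x \<in> topspace (X i)"
        using Mcl(2)[of l] Mtop[of l] p_in[of i l] ik by blast
    qed (use ik K(1) pK min in auto)
    also have "\<dots> \<subseteq> X i closure_of (p i k ` M k)" by (rule closure_of_mono) blast
    finally show ?thesis .
  qed
  \<comment> \<open>Restricting to \<open>A\<close> is only possible if \<open>A\<close> already contains \<open>M j\<close>; applied to both halves of a cover, this
    gives irreducibility.\<close>
  have half: "M j \<subseteq> A"
    if j: "j \<in> I" and A: "closedin (X j) A" and meet: "\<And>k. k \<in> I \<Longrightarrow> le j k \<Longrightarrow> \<exists>x\<in>M k \<inter> K k. p j k x \<in> A"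
    for j A
  proof -
    have "M j \<subseteq> X j closure_of (p j j ` {x \<in> M j. p j j x \<in> A})"
    proof (rule critical_restrict[where K = K])
      show "\<exists>x\<in>M k \<inter> K k. p j k x \<in> A" if "k \<in> I" "le j k" for k
        using meet that .
    qed (use j A K(1) pK min le_refl in auto)
    also have "\<dots> \<subseteq> A" using A by (intro closure_of_minimal) auto
    finally show ?thesis .
  qed
  have irr: "irreducible_closed_in (X j) (M j)" if j: "j \<in> I" for j
    unfolding irreducible_closed_in_def
  proof (intro conjI allI impI)
    show "closedin (X j) (M j)" "M j \<noteq> {}" using Mcl[OF j] by auto
    fix A B assume AB: "closedin (X j) A \<and> closedin (X j) B \<and> M j \<subseteq> A \<union> B"
    show "M j \<subseteq> A \<or> M j \<subseteq> B"
    proof (rule ccontr)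
      assume "\<not> (M j \<subseteq> A \<or> M j \<subseteq> B)"
      then obtain k l where kl: "k \<in> I" "le j k" "\<And>x. x \<in> M k \<inter> K k \<Longrightarrow> p j k x \<notin> A"
        "l \<in> I" "le j l" "\<And>x. x \<in> M l \<inter> K l \<Longrightarrow> p j l x \<notin> B"
        using half[OF j, of A] half[OF j, of B] AB by meson
      obtain m where m: "m \<in> I" "le k m" "le l m" using directed kl by blast
      obtain x where x: "x \<in> M m" "x \<in> K m" using Mcl(2) m by blast
      have xt: "x \<in> topspace (X m)" using x Mtop m by blast
      have "p k m x \<in> M k \<inter> K k" "p l m x \<in> M l \<inter> K l"
        using x pM pK kl m by blast+
      then have "p j k (p k m x) \<notin> A" "p j l (p l m x) \<notin> B" using kl by blast+
      then have "p j m x \<notin> A" "p j m x \<notin> B"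
        using p_p[OF j _ m(1) _ _ xt] kl m by metis+
      moreover have "p j m x \<in> M j" using pM[of j m] le_trans j kl m x by blast
      ultimately show False using AB by blast
    qed
  qed
  have "\<exists>x. x \<in> topspace (X j) \<and> M j = X j closure_of {x}" if "j \<in> I" for j
    using sober[OF that] irr[OF that] unfolding sober_space_def by blast
  then obtain x where x: "\<And>j. j \<in> I \<Longrightarrow> x j \<in> topspace (X j)"
    and Mx: "\<And>j. j \<in> I \<Longrightarrow> M j = X j closure_of {x j}"
    by metis
  have xM: "x j \<in> M j" if "j \<in> I" for j
    using Mx[OF that] x[OF that] closure_of_subset[of "{x j}" "X j"] by auto
  have "x j \<in> K j" if j: "j \<in> I" for j
  proof -
    obtain z where z: "z \<in> M j" "z \<in> K j" using Mcl(2)[OF j] by blast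
    have "specialization (X j) z (x j)"
      using z(1) x[OF j] unfolding Mx[OF j] specialization_def in_closure_of by auto
    then show ?thesis using K(2)[OF j] z(2) unfolding saturated_in_def by blast
  qed
  moreover have "p i j (x j) = x i" if ij: "i \<in> I" "j \<in> I" "le i j" for i j
  proof -
    have in_i: "p i j (x j) \<in> topspace (X i)" using p_in[OF ij x] ij by blast
    have "X i closure_of {p i j (x j)} = X i closure_of {x i}"
    proof
      have "p i j (x j) \<in> M i" using pM[OF ij] xM ij by blast
      then show "X i closure_of {p i j (x j)} \<subseteq> X i closure_of {x i}"
        using Mcl(1) ij by (intro closure_of_minimal) (auto simp: Mx)
      have "M i \<subseteq> X i closure_of (p i j ` M j)" by (rule dense[OF ij])
      also have "\<dots> \<subseteq> X i closure_of {p i j (x j)}"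
      proof (rule closure_of_minimal)
        have "p i j ` (X j closure_of {x j}) \<subseteq> X i closure_of (p i j ` {x j})"
          by (rule continuous_map_image_closure_subset[OF continuous_p[OF ij]])
        then show "p i j ` M j \<subseteq> X i closure_of {p i j (x j)}" using Mx ij by simp
      qed simp
      finally show "X i closure_of {x i} \<subseteq> X i closure_of {p i j (x j)}" using Mx ij by simp
    qed
    then have "\<forall>U. openin (X i) U \<longrightarrow> (p i j (x j) \<in> U \<longleftrightarrow> x i \<in> U)"
      using in_i x[OF ij(1)] by (auto simp: set_eq_iff in_closure_of) 
    moreover have "t0_space (X i)" using sober ij unfolding sober_space_def by blast
    ultimately show ?thesis
      using in_i x[OF ij(1)] unfolding t0_space_def by blast
  qed
  ultimately obtain i where "i \<in> I" "x i \<in> W i" using lim[of x] by blast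
  then show False using xM MW by blast
qed

section \<open>Threads and open sets of the limit\<close>

abbreviation lim where "lim \<equiv> projective_limit I le X p"

lemma topspace_lim:
  "topspace lim = {x \<in> (\<Pi>\<^sub>E i\<in>I. topspace (X i)). \<forall>i\<in>I. \<forall>j\<in>I. le i j \<longrightarrow> p i j (x j) = x i}"
  by (auto simp: projective_limit_def)

lemma lim_coordinate: "x \<in> topspace lim \<Longrightarrow> i \<in> I \<Longrightarrow> x i \<in> topspace (X i)"
  by (auto simp: topspace_lim)

lemma lim_thread: "x \<in> topspace lim \<Longrightarrow> i \<in> I \<Longrightarrow> j \<in> I \<Longrightarrow> le i j \<Longrightarrow> p i j (x j) = x i"
  by (simp add: topspace_lim)

lemma continuous_coordinate: "i \<in> I \<Longrightarrow> continuous_map lim (X i) (\<lambda>x. x i)"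
  unfolding projective_limit_def
  by (intro continuous_map_from_subtopology continuous_map_product_projection)

lemma finite_upper_bound:
  assumes "finite A" "A \<subseteq> I"
  shows "\<exists>k\<in>I. \<forall>i\<in>A. le i k"
  using assms
proof (induction rule: finite_induct)
  case empty
  then show ?case using nonempty by auto
next
  case (insert i A)
  then obtain k where k: "k \<in> I" "\<forall>i\<in>A. le i k" by auto
  obtain l where l: "l \<in> I" "le i l" "le k l" using directed[of i k] insert.prems k by blast
  have "le i' l" if "i' \<in> A" for i' using le_trans[of i' k l] k l insert.prems that by blast
  then show ?case using l by blast
qed

text \<open>
  A basic open set of the product restricts finitely many coordinates, and all of them can be read off from one
  coordinate \<open>k\<close> above them.
\<close>
lemma lim_open_base:
  assumes U: "openin lim U" and x: "x \<in> U"
  obtains k V where "k \<in> I" "openin (X k) V" "x k \<in> V" "\<And>y. y \<in> topspace lim \<Longrightarrow> y k \<in> V \<Longrightarrow> y \<in> U"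
proof -
  have xl: "x \<in> topspace lim" using U x openin_subset by blast
  have "openin (subtopology (product_topology X I) (topspace lim)) U"
    by (subst topspace_lim) (use U in \<open>simp only: projective_limit_def\<close>)
  then obtain T where T: "openin (product_topology X I) T" "U = T \<inter> topspace lim"
    unfolding openin_subtopology by blast
  have "x \<in> T" using x T(2) by blast
  with T(1) have "\<exists>B. finite {i \<in> I. B i \<noteq> topspace (X i)} \<and> (\<forall>i\<in>I. openin (X i) (B i)) \<and>
      x \<in> (\<Pi>\<^sub>E i\<in>I. B i) \<and> (\<Pi>\<^sub>E i\<in>I. B i) \<subseteq> T"
    unfolding openin_product_topology_alt by simp
  then obtain B where B: "finite {i \<in> I. B i \<noteq> topspace (X i)}" "\<And>i. i \<in> I \<Longrightarrow> openin (X i) (B i)"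
     "x \<in> (\<Pi>\<^sub>E i\<in>I. B i)" "(\<Pi>\<^sub>E i\<in>I. B i) \<subseteq> T"
    by blast
  let ?A = "{i \<in> I. B i \<noteq> topspace (X i)}"
  obtain k where k: "k \<in> I" "\<And>i. i \<in> ?A \<Longrightarrow> le i k" using finite_upper_bound[OF B(1)] by blast
  define V where "V = topspace (X k) \<inter> (\<Inter>i\<in>?A. {z \<in> topspace (X k). p i k z \<in> B i})"
  show thesis
  proof (rule that[OF k(1)])
    have "openin (X k) (topspace (X k) \<inter> (\<Inter>i\<in>?A. {z \<in> topspace (X k). p i k z \<in> B i}))"
    proof (cases "?A = {}")
      case False
      have "openin (X k) {z \<in> topspace (X k). p i k z \<in> B i}" if i: "i \<in> ?A" for i
        using i B(2) k(1) k(2)[OF i] by (intro openin_continuous_map_preimage[OF continuous_p]) auto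
      then show ?thesis
        using False B(1) by (intro openin_Int openin_topspace openin_Inter) auto
    next
      case True
      show ?thesis unfolding True by simp
    qed
    then show "openin (X k) V" by (simp add: V_def)
    show "x k \<in> V"
      using B(3) k lim_thread[OF xl] lim_coordinate[OF xl] by (auto simp: V_def)
    fix y assume y: "y \<in> topspace lim" "y k \<in> V"
    have "y i \<in> B i" if i: "i \<in> I" for i
    proof (cases "i \<in> ?A")
      case True
      then have "p i k (y k) \<in> B i" using y(2) by (simp add: V_def)
      then show ?thesis using lim_thread[OF y(1) i k(1) k(2)[OF True]] by simp
    next
      case False
      then show ?thesis using lim_coordinate[OF y(1) i] i by simp
    qed
    then have "y \<in> (\<Pi>\<^sub>E i\<in>I. B i)" using y(1) by (auto simp: topspace_lim PiE_def)
    then show "y \<in> U" using B(4) T y(1) by blast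
  qed
qed

text \<open>
  The index set is replaced by another directed preorder \<open>J\<close>, possibly of another type, so that both an up-set
  of \<open>I\<close> and a cofinal sequence in \<open>I\<close> (which may repeat indices) are covered.
\<close>
definition cofinal_reindexing :: "'j set \<Rightarrow> ('j \<Rightarrow> 'j \<Rightarrow> bool) \<Rightarrow> ('j \<Rightarrow> 'i) \<Rightarrow> bool" where
  "cofinal_reindexing J leJ a \<longleftrightarrow>
     reflp_on J leJ \<and> transp_on J leJ \<and> directed_on J leJ \<and> a ` J \<subseteq> I \<and>
     (\<forall>j\<in>J. \<forall>k\<in>J. leJ j k \<longrightarrow> le (a j) (a k)) \<and> (\<forall>i\<in>I. \<exists>j\<in>J. le i (a j))"

lemma extend_cofinal_thread:
  assumes J: "cofinal_reindexing J leJ a"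
    and y: "\<And>j. j \<in> J \<Longrightarrow> y j \<in> topspace (X (a j))"
    and thread: "\<And>j k. j \<in> J \<Longrightarrow> k \<in> J \<Longrightarrow> leJ j k \<Longrightarrow> p (a j) (a k) (y k) = y j"
  obtains x where "x \<in> topspace lim" "\<And>j. j \<in> J \<Longrightarrow> x (a j) = y j"
proof -
  have a: "\<And>j. j \<in> J \<Longrightarrow> a j \<in> I" "\<And>j k. j \<in> J \<Longrightarrow> k \<in> J \<Longrightarrow> leJ j k \<Longrightarrow> le (a j) (a k)"
    and dir: "directed_on J leJ" and cofinal: "\<And>i. i \<in> I \<Longrightarrow> \<exists>j\<in>J. le i (a j)"
    using J unfolding cofinal_reindexing_def by blast+
  have same: "p i (a j) (y j) = p i (a k) (y k)"
    if "i \<in> I" "j \<in> J" "k \<in> J" "le i (a j)" "le i (a k)" for i j k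
  proof -
    obtain l where l: "l \<in> J" "leJ j l" "leJ k l" using dir \<open>j \<in> J\<close> \<open>k \<in> J\<close> unfolding directed_on_def by blast
    have "p i (a m) (y m) = p i (a l) (y l)" if "m \<in> J" "leJ m l" "le i (a m)" for m
      using p_p[OF \<open>i \<in> I\<close> a(1)[OF \<open>m \<in> J\<close>] a(1)[OF l(1)] _ a(2)[OF _ l(1)] y[OF l(1)]] that
        thread[OF _ l(1)] by metis
    then show ?thesis using that l by metis
  qed
  obtain f where f: "\<And>i. i \<in> I \<Longrightarrow> f i \<in> J" "\<And>i. i \<in> I \<Longrightarrow> le i (a (f i))" using cofinal by metis
  define x where "x = (\<lambda>i\<in>I. p i (a (f i)) (y (f i)))"
  have xi: "x i = p i (a j) (y j)" if "i \<in> I" "j \<in> J" "le i (a j)" for i j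
    using same[OF that(1) f(1)[OF that(1)] that(2) f(2)[OF that(1)] that(3)] that(1) by (simp add: x_def)
  have "x \<in> topspace lim"
    unfolding topspace_lim
  proof (intro CollectI conjI ballI impI)
    show "x \<in> (\<Pi>\<^sub>E i\<in>I. topspace (X i))"
      unfolding x_def using f a(1) y p_in by (intro restrict_PiE_iff[THEN iffD2] ballI) blast
    fix i j assume ij: "i \<in> I" "j \<in> I" "le i j"
    have "x i = p i (a (f j)) (y (f j))" using xi ij f le_trans a(1) by metis
    also have "\<dots> = p i j (x j)"
      using p_p[OF ij(1,2) a(1)[OF f(1)[OF ij(2)]] ij(3) f(2)[OF ij(2)] y[OF f(1)[OF ij(2)]]] ij
      by (simp add: x_def)
    finally show "p i j (x j) = x i" by simp
  qed
  moreover have "x (a j) = y j" if "j \<in> J" for j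
    using xi[OF a(1)[OF that] that le_refl[OF a(1)[OF that]]] p_id[OF a(1)[OF that] y[OF that]] by simp
  ultimately show thesis by (rule that)
qed

lemma upper_set_cofinal:
  assumes i: "i \<in> I"
  shows "cofinal_reindexing {j \<in> I. le i j} le (\<lambda>j. j)"
  unfolding cofinal_reindexing_def
proof (intro conjI ballI impI)
  show "reflp_on {j \<in> I. le i j} le" "transp_on {j \<in> I. le i j} le"
    using system unfolding projective_system_def by (auto intro: reflp_on_subset transp_on_subset)
  show "directed_on {j \<in> I. le i j} le"
    unfolding directed_on_def
  proof (intro conjI ballI)
    show "{j \<in> I. le i j} \<noteq> {}" using i le_refl by blast
    fix j k assume "j \<in> {j \<in> I. le i j}" "k \<in> {j \<in> I. le i j}"
    then have jk: "j \<in> I" "k \<in> I" "le i j" by auto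
    obtain l where "l \<in> I" "le j l" "le k l" using directed jk by blast
    then show "\<exists>l\<in>{j \<in> I. le i j}. le j l \<and> le k l" using le_trans i jk by blast
  qed
  fix m assume "m \<in> I"
  then obtain l where "l \<in> I" "le i l" "le m l" using directed i by blast
  then show "\<exists>j\<in>{j \<in> I. le i j}. le m j" by blast
qed auto

section \<open>Gluing a compatible family of previsions\<close>

text \<open>
  Such families present the lower semicontinuous functions on the limit: \<open>h i (x i)\<close> increases with \<open>i\<close> along each
  thread \<open>x\<close>, and the function presented is its supremum.
\<close>
definition increasing :: "('i \<Rightarrow> 'a \<Rightarrow> ennreal) \<Rightarrow> bool" where
  "increasing h \<longleftrightarrow> (\<forall>i\<in>I. h i \<in> lsc_maps (X i)) \<and>
     (\<forall>i\<in>I. \<forall>j\<in>I. le i j \<longrightarrow> (\<forall>x\<in>topspace (X j). h i (p i j x) \<le> h j x))"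

definition compatible :: "('i \<Rightarrow> ('a \<Rightarrow> ennreal) \<Rightarrow> ennreal) \<Rightarrow> bool" where
  "compatible F \<longleftrightarrow> (\<forall>i\<in>I. prevision (X i) (F i)) \<and>
     (\<forall>i\<in>I. \<forall>j\<in>I. le i j \<longrightarrow> (\<forall>h\<in>lsc_maps (X i). F j (\<lambda>x\<in>topspace (X j). h (p i j x)) = F i h))"

text \<open>
  The inequality in the hypothesis is tested on threads only, whereas \<open>F i g\<close> depends on the values of \<open>g\<close> on all
  of \<open>X i\<close>; this is the point at which the geometry of the system enters.
\<close>
definition limit_monotone :: "('i \<Rightarrow> ('a \<Rightarrow> ennreal) \<Rightarrow> ennreal) \<Rightarrow> bool" where
  "limit_monotone F \<longleftrightarrow>
     (\<forall>i\<in>I. \<forall>g\<in>lsc_maps (X i). \<forall>h. increasing h \<longrightarrow>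
        (\<forall>x\<in>topspace lim. g (x i) \<le> (SUP j\<in>I. h j (x j))) \<longrightarrow>
        F i g \<le> (SUP j\<in>I. F j (h j)))"

lemma limit_monotoneD:
  assumes "limit_monotone F" "i \<in> I" "g \<in> lsc_maps (X i)" "increasing h"
    and "\<And>x. x \<in> topspace lim \<Longrightarrow> g (x i) \<le> (SUP j\<in>I. h j (x j))"
  shows "F i g \<le> (SUP j\<in>I. F j (h j))"
  using assms by (simp add: limit_monotone_def)

lemma increasing_lsc: "increasing h \<Longrightarrow> i \<in> I \<Longrightarrow> h i \<in> lsc_maps (X i)"
  by (simp add: increasing_def)

lemma increasing_le: "increasing h \<Longrightarrow> i \<in> I \<Longrightarrow> j \<in> I \<Longrightarrow> le i j \<Longrightarrow> x \<in> topspace (X j) \<Longrightarrow> h i (p i j x) \<le> h j x"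
  by (simp add: increasing_def)

lemma increasing_lim:
  assumes "increasing h" "x \<in> topspace lim" "i \<in> I" "j \<in> I" "le i j"
  shows "h i (x i) \<le> h j (x j)"
  using increasing_le[OF assms(1,3,4,5) lim_coordinate[OF assms(2,4)]] lim_thread[OF assms(2,3,4,5)] by simp

definition lower_approx :: "(('i \<Rightarrow> 'a) \<Rightarrow> ennreal) \<Rightarrow> 'i \<Rightarrow> 'a \<Rightarrow> ennreal" where
  "lower_approx h i = (\<lambda>z\<in>topspace (X i).
     SUP g\<in>{g \<in> lsc_maps (X i). \<forall>x\<in>topspace lim. g (x i) \<le> h x}. g z)"

lemma lower_approx_lsc: "lower_approx h i \<in> lsc_maps (X i)"
  unfolding lower_approx_def by (rule lsc_maps_SUP) simp

lemma lower_approx_le: "x \<in> topspace lim \<Longrightarrow> i \<in> I \<Longrightarrow> lower_approx h i (x i) \<le> h x"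
  by (auto simp: lower_approx_def lim_coordinate intro: SUP_least)

lemma lower_approx_greatest:
  assumes "g \<in> lsc_maps (X i)" "\<And>x. x \<in> topspace lim \<Longrightarrow> g (x i) \<le> h x" "z \<in> topspace (X i)"
  shows "g z \<le> lower_approx h i z"
  using assms by (auto simp: lower_approx_def intro: SUP_upper)

lemma lower_approx_mono:
  assumes "i \<in> I" "\<And>x. x \<in> topspace lim \<Longrightarrow> h x \<le> h' x" "z \<in> topspace (X i)"
  shows "lower_approx h i z \<le> lower_approx h' i z"
  using assms lower_approx_le[of _ i h] by (intro lower_approx_greatest lower_approx_lsc) (auto intro: order_trans)

lemma lower_approx_increasing: "increasing (lower_approx h)"
  unfolding increasing_def
proof (intro conjI ballI impI lower_approx_lsc)
  fix i j z assume ij: "i \<in> I" "j \<in> I" "le i j" and z: "z \<in> topspace (X j)"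
  let ?g = "\<lambda>z\<in>topspace (X j). lower_approx h i (p i j z)"
  have "?g z \<le> lower_approx h j z"
  proof (rule lower_approx_greatest[OF _ _ z])
    show "?g \<in> lsc_maps (X j)" using continuous_p[OF ij] lower_approx_lsc by (rule lsc_maps_pullback)
    fix x assume "x \<in> topspace lim"
    then show "?g (x j) \<le> h x"
      using lower_approx_le[of x i h] ij by (simp add: lim_coordinate lim_thread)
  qed
  then show "lower_approx h i (p i j z) \<le> lower_approx h j z" using z by simp
qed

text \<open>
  If \<open>h x > t\<close>, then \<open>h > t\<close> on a basic neighbourhood given by an open \<open>V\<close> in some \<open>X k\<close>, and the function equal to
  \<open>t\<close> on \<open>V\<close> and \<open>0\<close> elsewhere is one of the functions in the supremum that defines \<open>lower_approx h k\<close>.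
\<close>
lemma lower_approx_SUP:
  assumes h: "h \<in> lsc_maps lim" and x: "x \<in> topspace lim"
  shows "(SUP i\<in>I. lower_approx h i (x i)) = h x"
proof (rule antisym)
  show "(SUP i\<in>I. lower_approx h i (x i)) \<le> h x"
    using lower_approx_le[OF x] by (rule SUP_least)
  show "h x \<le> (SUP i\<in>I. lower_approx h i (x i))"
  proof (rule dense_le)
    fix t assume "t < h x"
    then have "x \<in> {x \<in> topspace lim. t < h x}" using x by simp
    from lim_open_base[OF lsc_maps_openin[OF h] this]
    obtain k V where k: "k \<in> I" "openin (X k) V" "x k \<in> V"
      and V: "\<And>y. y \<in> topspace lim \<Longrightarrow> y k \<in> V \<Longrightarrow> y \<in> {x \<in> topspace lim. t < h x}" by blast
    let ?g = "step_function (X k) 1 (\<lambda>_. t) (\<lambda>_. V)"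
    have "t \<le> ?g (x k)" using step_function_ge[of "x k" "X k" 0 1 "\<lambda>_. V" "\<lambda>_. t"] k lim_coordinate[OF x] by simp
    also have "\<dots> \<le> lower_approx h k (x k)"
    proof (rule lower_approx_greatest)
      show "?g \<in> lsc_maps (X k)" using k by (intro step_function_lsc)
      show "?g (y k) \<le> h y" if "y \<in> topspace lim" for y
        using V that k lim_coordinate by (intro step_function_le) (auto intro: less_imp_le)
      show "x k \<in> topspace (X k)" using lim_coordinate[OF x k(1)] .
    qed
    also have "\<dots> \<le> (SUP i\<in>I. lower_approx h i (x i))" using k by (intro SUP_upper)
    finally show "t \<le> (SUP i\<in>I. lower_approx h i (x i))" .
  qed
qed

lemma lsc_maps_as_SUP:
  assumes h: "h \<in> lsc_maps lim"
  shows "h = (\<lambda>x\<in>topspace lim. SUP i\<in>I. lower_approx h i (x i))"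
  using lower_approx_SUP[OF h] lsc_maps_restrict[OF h] by (metis (no_types, lifting) restrict_ext)

lemma lsc_maps_SUP_coordinates:
  assumes "increasing g"
  shows "(\<lambda>x\<in>topspace lim. SUP i\<in>I. g i (x i)) \<in> lsc_maps lim"
proof -
  have "(\<lambda>x\<in>topspace lim. SUP i\<in>I. (\<lambda>x\<in>topspace lim. g i (x i)) x) \<in> lsc_maps lim"
    using increasing_lsc[OF assms] continuous_coordinate by (intro lsc_maps_SUP lsc_maps_pullback)
  then show ?thesis by (simp cong: restrict_cong)
qed

lemma prevision_on_lim:
  assumes F: "prevision lim F" and h: "h \<in> lsc_maps lim"
  shows "F h = (SUP i\<in>I. F (\<lambda>x\<in>topspace lim. lower_approx h i (x i)))"
proof -
  have "h = (\<lambda>x\<in>topspace lim. SUP i\<in>I. (\<lambda>x\<in>topspace lim. lower_approx h i (x i)) x)"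
    using lsc_maps_as_SUP[OF h] by (simp cong: restrict_cong)
  then have "F h = F (\<lambda>x\<in>topspace lim. SUP i\<in>I. (\<lambda>x\<in>topspace lim. lower_approx h i (x i)) x)"
    by (rule arg_cong)
  also have "\<dots> = (SUP i\<in>I. F (\<lambda>x\<in>topspace lim. lower_approx h i (x i)))"
  proof (rule prevision_SUP[OF F nonempty])
    show "(\<lambda>x\<in>topspace lim. lower_approx h i (x i)) \<in> lsc_maps lim" if "i \<in> I" for i
      using that continuous_coordinate lower_approx_lsc by (intro lsc_maps_pullback)
    fix i j assume ij: "i \<in> I" "j \<in> I"
    then obtain k where "k \<in> I" "le i k" "le j k" using directed by blast
    then show "\<exists>k\<in>I. \<forall>x\<in>topspace lim.
        (\<lambda>x\<in>topspace lim. lower_approx h i (x i)) x \<le> (\<lambda>x\<in>topspace lim. lower_approx h k (x k)) x \<and>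
        (\<lambda>x\<in>topspace lim. lower_approx h j (x j)) x \<le> (\<lambda>x\<in>topspace lim. lower_approx h k (x k)) x"
      using increasing_lim[OF lower_approx_increasing] ij by (intro bexI[of _ k]) auto
  qed
  finally show ?thesis .
qed

definition glue :: "('i \<Rightarrow> ('a \<Rightarrow> ennreal) \<Rightarrow> ennreal) \<Rightarrow> (('i \<Rightarrow> 'a) \<Rightarrow> ennreal) \<Rightarrow> ennreal" where
  "glue F = (\<lambda>h\<in>lsc_maps lim. SUP i\<in>I. F i (lower_approx h i))"

text \<open>
  Each \<open>g i\<close> lies below the best approximation at \<open>i\<close>, which gives one inequality by monotonicity. The other is an
  instance of \<open>limit_monotone\<close>, because the best approximations are dominated along threads by the family \<open>g\<close>.
\<close>
lemma glue_SUP: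
  assumes F: "compatible F" "limit_monotone F" and g: "increasing g"
  shows "glue F (\<lambda>x\<in>topspace lim. SUP i\<in>I. g i (x i)) = (SUP i\<in>I. F i (g i))"
proof -
  let ?h = "\<lambda>x\<in>topspace lim. SUP i\<in>I. g i (x i)"
  have "glue F ?h = (SUP i\<in>I. F i (lower_approx ?h i))"
    using lsc_maps_SUP_coordinates[OF g] by (simp add: glue_def)
  also have "\<dots> = (SUP i\<in>I. F i (g i))"
  proof (rule antisym; rule SUP_least)
    fix i assume i: "i \<in> I"
    show "F i (lower_approx ?h i) \<le> (SUP i\<in>I. F i (g i))"
    proof (rule limit_monotoneD[OF F(2) i lower_approx_lsc g])
      fix x assume "x \<in> topspace lim"
      then show "lower_approx ?h i (x i) \<le> (SUP j\<in>I. g j (x j))"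
        using lower_approx_le[of x i ?h] i by simp
    qed
  next
    fix i assume i: "i \<in> I"
    have "F i (g i) \<le> F i (lower_approx ?h i)"
    proof (rule prevision_mono[of "X i" "F i"])
      show "prevision (X i) (F i)" using F(1) i by (simp add: compatible_def)
      show "g i \<in> lsc_maps (X i)" using increasing_lsc[OF g i] .
      then show "g i z \<le> lower_approx ?h i z" if "z \<in> topspace (X i)" for z
        using that i by (intro lower_approx_greatest) (auto intro: SUP_upper)
    qed (rule lower_approx_lsc)
    also have "\<dots> \<le> (SUP i\<in>I. F i (lower_approx ?h i))" using i by (rule SUP_upper)
    finally show "F i (g i) \<le> (SUP i\<in>I. F i (lower_approx ?h i))" .
  qed
  finally show ?thesis .
qed

text \<open>
  The function \<open>g (x i)\<close> on threads is the supremum of the increasing family equal to \<open>g \<circ> p i k\<close> at the indices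
  \<open>k\<close> above \<open>i\<close> and to \<open>0\<close> at the others; on it \<open>F\<close> takes the values \<open>F i g\<close> and \<open>0\<close>.
\<close>
lemma glue_coordinate:
  assumes F: "compatible F" "limit_monotone F" and i: "i \<in> I" and g: "g \<in> lsc_maps (X i)"
  shows "glue F (\<lambda>x\<in>topspace lim. g (x i)) = F i g"
proof -
  define h where "h = (\<lambda>k. if le i k then (\<lambda>z\<in>topspace (X k). g (p i k z)) else (\<lambda>z\<in>topspace (X k). 0))"
  have h: "increasing h"
    unfolding increasing_def
  proof (intro conjI ballI impI)
    show "h k \<in> lsc_maps (X k)" if "k \<in> I" for k
      using lsc_maps_pullback[OF continuous_p[OF i that] g] by (simp add: h_def lsc_maps_const)
    fix j k z assume jk: "j \<in> I" "k \<in> I" "le j k" "z \<in> topspace (X k)"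
    show "h j (p j k z) \<le> h k z"
    proof (cases "le i j")
      case True
      then have "le i k" using le_trans i jk by blast
      then show ?thesis using True p_p[OF i jk(1,2) True jk(3,4)] p_in[OF jk] jk by (simp add: h_def)
    qed (use p_in[OF jk] in \<open>simp add: h_def\<close>)
  qed
  have hx: "h k (x k) = (if le i k then g (x i) else 0)" if "x \<in> topspace lim" "k \<in> I" for x k
    using that i by (simp add: h_def lim_thread lim_coordinate)
  have Fh: "F k (h k) = (if le i k then F i g else 0)" if "k \<in> I" for k
    using F(1) i that g by (simp add: h_def compatible_def prevision_zero)
  have sup: "(SUP k\<in>I. (if le i k then c else 0)) = c" for c :: ennreal
    using i le_refl[OF i] by (intro antisym SUP_least SUP_upper2[of i]) auto
  have "(\<lambda>x\<in>topspace lim. g (x i)) = (\<lambda>x\<in>topspace lim. SUP k\<in>I. h k (x k))"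
    using hx sup by (intro restrict_ext) (simp cong: SUP_cong)
  then have "glue F (\<lambda>x\<in>topspace lim. g (x i)) = (SUP k\<in>I. F k (h k))"
    using glue_SUP[OF F h] by simp
  then show ?thesis using Fh sup by (simp cong: SUP_cong)
qed

lemma increasing_pointwise:
  assumes "\<And>i z. i \<in> I \<Longrightarrow> z \<in> topspace (X i) \<Longrightarrow> k i z = \<phi> (h i z) (h' i z)"
    and "\<And>i. i \<in> I \<Longrightarrow> k i \<in> lsc_maps (X i)"
    and "increasing h" "increasing h'"
    and "\<And>a a' b b'. a \<le> a' \<Longrightarrow> b \<le> b' \<Longrightarrow> \<phi> a b \<le> \<phi> a' b'"
  shows "increasing k"
  unfolding increasing_def using assms p_in increasing_le by (metis (no_types, lifting))

text \<open>
  For Scott continuity as for homogeneity, the best approximations of the given functions are combined coordinate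
  by coordinate into an increasing family with the required supremum, and \<open>glue_SUP\<close> evaluates \<open>glue F\<close> on it.
\<close>
lemma glue_prevision:
  assumes F: "compatible F" "limit_monotone F"
  shows "prevision lim (glue F)"
proof (rule previsionI)
  have pr: "prevision (X i) (F i)" if "i \<in> I" for i using F(1) that by (simp add: compatible_def)
  show "glue F \<in> extensional (lsc_maps lim)" by (simp add: glue_def)
  show "glue F h \<le> glue F g"
    if hg: "h \<in> lsc_maps lim" "g \<in> lsc_maps lim" "\<And>x. x \<in> topspace lim \<Longrightarrow> h x \<le> g x" for h g
  proof -
    have "F i (lower_approx h i) \<le> F i (lower_approx g i)" if i: "i \<in> I" for i
      by (rule prevision_mono[OF pr[OF i] lower_approx_lsc lower_approx_lsc])
         (rule lower_approx_mono[OF i hg(3)])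
    then have "(SUP i\<in>I. F i (lower_approx h i)) \<le> (SUP i\<in>I. F i (lower_approx g i))"
      by (rule SUP_subset_mono[OF order_refl])
    then show ?thesis using hg by (simp add: glue_def)
  qed
  fix D assume D: "D \<subseteq> lsc_maps lim" "D \<noteq> {}"
    "\<And>c d. c \<in> D \<Longrightarrow> d \<in> D \<Longrightarrow> \<exists>e\<in>D. \<forall>x\<in>topspace lim. c x \<le> e x \<and> d x \<le> e x"
  define g where "g = (\<lambda>i. \<lambda>z\<in>topspace (X i). SUP d\<in>D. lower_approx d i z)"
  have g: "increasing g"
    unfolding increasing_def
  proof (intro conjI ballI impI)
    show "g i \<in> lsc_maps (X i)" for i unfolding g_def by (intro lsc_maps_SUP lower_approx_lsc)
    fix i j z assume ij: "i \<in> I" "j \<in> I" "le i j" "z \<in> topspace (X j)"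
    then show "g i (p i j z) \<le> g j z"
      using increasing_le[OF lower_approx_increasing] p_in by (auto simp: g_def intro!: SUP_subset_mono)
  qed
  have "(SUP d\<in>D. d x) = (SUP i\<in>I. g i (x i))" if x: "x \<in> topspace lim" for x
  proof -
    have "(SUP d\<in>D. d x) = (SUP d\<in>D. SUP i\<in>I. lower_approx d i (x i))"
      using lower_approx_SUP[OF _ x] D(1) by (intro SUP_cong) auto
    also have "\<dots> = (SUP i\<in>I. SUP d\<in>D. lower_approx d i (x i))" by (rule SUP_commute)
    also have "\<dots> = (SUP i\<in>I. g i (x i))"
      using lim_coordinate[OF x] by (intro SUP_cong) (auto simp: g_def)
    finally show ?thesis .
  qed
  then have "glue F (\<lambda>x\<in>topspace lim. SUP d\<in>D. d x) = glue F (\<lambda>x\<in>topspace lim. SUP i\<in>I. g i (x i))"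
    by (intro arg_cong[of _ _ "glue F"] restrict_ext)
  also have "\<dots> = (SUP i\<in>I. F i (g i))" by (rule glue_SUP[OF F g])
  also have "\<dots> = (SUP i\<in>I. SUP d\<in>D. F i (lower_approx d i))"
  proof (rule SUP_cong[OF refl])
    fix i assume i: "i \<in> I"
    show "F i (g i) = (SUP d\<in>D. F i (lower_approx d i))"
      unfolding g_def
    proof (rule prevision_SUP[OF pr[OF i] D(2) lower_approx_lsc])
      fix c d assume "c \<in> D" "d \<in> D"
      then obtain e where "e \<in> D" "\<forall>x\<in>topspace lim. c x \<le> e x \<and> d x \<le> e x" using D(3) by blast
      then show "\<exists>e\<in>D. \<forall>z\<in>topspace (X i). lower_approx c i z \<le> lower_approx e i z \<and> lower_approx d i z \<le> lower_approx e i z"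
        using lower_approx_mono[OF i] by (intro bexI[of _ e]) auto
    qed
  qed
  also have "\<dots> = (SUP d\<in>D. SUP i\<in>I. F i (lower_approx d i))" by (rule SUP_commute)
  also have "\<dots> = (SUP d\<in>D. glue F d)"
    using D(1) by (intro SUP_cong) (auto simp: glue_def)
  finally show "glue F (\<lambda>x\<in>topspace lim. SUP d\<in>D. d x) \<le> (SUP d\<in>D. glue F d)" by simp
next
  fix h and a :: real assume h: "h \<in> lsc_maps lim" "0 \<le> a"
  let ?g = "\<lambda>i. \<lambda>z\<in>topspace (X i). ennreal a * lower_approx h i z"
  have g: "increasing ?g"
    using lower_approx_increasing[of h] lower_approx_increasing[of h]
    by (rule increasing_pointwise[where \<phi> = "\<lambda>u v. ennreal a * u", rotated 2])
       (auto intro: lsc_maps_mult lower_approx_lsc mult_left_mono)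
  have "glue F (\<lambda>x\<in>topspace lim. ennreal a * h x) = glue F (\<lambda>x\<in>topspace lim. SUP i\<in>I. ?g i (x i))"
  proof (intro arg_cong[of _ _ "glue F"] restrict_ext)
    fix x assume x: "x \<in> topspace lim"
    then have "(SUP i\<in>I. ?g i (x i)) = (SUP i\<in>I. ennreal a * lower_approx h i (x i))"
      by (intro SUP_cong) (auto simp: lim_coordinate)
    then show "ennreal a * h x = (SUP i\<in>I. ?g i (x i))"
      by (simp only: SUP_mult_left_ennreal[symmetric] lower_approx_SUP[OF h(1) x])
  qed
  also have "\<dots> = (SUP i\<in>I. F i (?g i))" by (rule glue_SUP[OF F g])
  also have "\<dots> = (SUP i\<in>I. ennreal a * F i (lower_approx h i))"
    using F(1) h(2) by (intro SUP_cong refl prevision_mult lower_approx_lsc) (auto simp: compatible_def)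
  also have "\<dots> = ennreal a * glue F h" using h(1) by (simp add: glue_def SUP_mult_left_ennreal)
  finally show "glue F (\<lambda>x\<in>topspace lim. ennreal a * h x) = ennreal a * glue F h" .
qed

lemma glue_sublinear:
  assumes F: "compatible F" "limit_monotone F" and sub: "\<And>i. i \<in> I \<Longrightarrow> sublinear_on (X i) (F i)"
  shows "sublinear_on lim (glue F)"
  unfolding sublinear_on_def
proof (intro ballI)
  fix h h' assume h: "h \<in> lsc_maps lim" "h' \<in> lsc_maps lim"
  let ?g = "\<lambda>i. \<lambda>z\<in>topspace (X i). lower_approx h i z + lower_approx h' i z"
  have g: "increasing ?g"
    using lower_approx_increasing[of h] lower_approx_increasing[of h']
    by (rule increasing_pointwise[where \<phi> = "(+)", rotated 2])
       (auto intro: lsc_maps_add lower_approx_lsc add_mono)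
  have "glue F (\<lambda>x\<in>topspace lim. h x + h' x) = glue F (\<lambda>x\<in>topspace lim. SUP i\<in>I. ?g i (x i))"
  proof (intro arg_cong[of _ _ "glue F"] restrict_ext)
    fix x assume x: "x \<in> topspace lim"
    then have "(SUP i\<in>I. ?g i (x i)) = (SUP i\<in>I. lower_approx h i (x i) + lower_approx h' i (x i))"
      by (intro SUP_cong) (auto simp: lim_coordinate)
    also have "\<dots> = (SUP i\<in>I. lower_approx h i (x i)) + (SUP i\<in>I. lower_approx h' i (x i))"
    proof (rule SUP_add_directed_ennreal)
      fix i j assume ij: "i \<in> I" "j \<in> I"
      then obtain k where "k \<in> I" "le i k" "le j k" using directed by blast
      then show "\<exists>k\<in>I. lower_approx h i (x i) + lower_approx h' j (x j) \<le> lower_approx h k (x k) + lower_approx h' k (x k)"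
        using ij by (intro bexI[of _ k] add_mono increasing_lim[OF lower_approx_increasing x])
    qed
    finally show "h x + h' x = (SUP i\<in>I. ?g i (x i))"
      by (simp only: lower_approx_SUP[OF h(1) x] lower_approx_SUP[OF h(2) x])
  qed
  also have "\<dots> = (SUP i\<in>I. F i (?g i))" by (rule glue_SUP[OF F g])
  also have "\<dots> \<le> glue F h + glue F h'"
  proof (rule SUP_least)
    fix i assume i: "i \<in> I"
    have "F i (?g i) \<le> F i (lower_approx h i) + F i (lower_approx h' i)"
      using sub[OF i] lower_approx_lsc unfolding sublinear_on_def by blast
    also have "\<dots> \<le> glue F h + glue F h'"
      using h i by (auto simp: glue_def intro!: add_mono SUP_upper)
    finally show "F i (?g i) \<le> glue F h + glue F h'" .
  qed
  finally show "glue F (\<lambda>x\<in>topspace lim. h x + h' x) \<le> glue F h + glue F h'" .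
qed

lemma glue_add_one:
  assumes F: "compatible F" "limit_monotone F" and h: "h \<in> lsc_maps lim"
  shows "glue F (\<lambda>x\<in>topspace lim. 1 + h x) = (SUP i\<in>I. F i (\<lambda>z\<in>topspace (X i). 1 + lower_approx h i z))"
proof -
  let ?g = "\<lambda>i. \<lambda>z\<in>topspace (X i). 1 + lower_approx h i z"
  have g: "increasing ?g"
    using lower_approx_increasing[of h] lower_approx_increasing[of h]
    by (rule increasing_pointwise[where \<phi> = "\<lambda>u v. 1 + u", rotated 2])
       (auto intro: lsc_maps_add_const lower_approx_lsc)
  have "glue F (\<lambda>x\<in>topspace lim. 1 + h x) = glue F (\<lambda>x\<in>topspace lim. SUP i\<in>I. ?g i (x i))"
  proof (intro arg_cong[of _ _ "glue F"] restrict_ext)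
    fix x assume x: "x \<in> topspace lim"
    then have "(SUP i\<in>I. ?g i (x i)) = (SUP i\<in>I. 1 + lower_approx h i (x i))"
      by (intro SUP_cong) (auto simp: lim_coordinate)
    then show "1 + h x = (SUP i\<in>I. ?g i (x i))"
      by (simp only: ennreal_SUP_add_right[OF nonempty, symmetric] lower_approx_SUP[OF h x])
  qed
  also have "\<dots> = (SUP i\<in>I. F i (?g i))" by (rule glue_SUP[OF F g])
  finally show ?thesis .
qed

lemma glue_normality:
  assumes F: "compatible F" "limit_monotone F" and nor: "\<And>i. i \<in> I \<Longrightarrow> satisfies_normality b (X i) (F i)"
  shows "satisfies_normality b lim (glue F)"
proof (cases b)
  case Subnormalized
  have "glue F (\<lambda>x\<in>topspace lim. 1 + h x) \<le> 1 + glue F h" if h: "h \<in> lsc_maps lim" for h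
  proof -
    have "glue F (\<lambda>x\<in>topspace lim. 1 + h x) \<le> (SUP i\<in>I. 1 + F i (lower_approx h i))"
      unfolding glue_add_one[OF F h] using nor lower_approx_lsc Subnormalized
      by (intro SUP_subset_mono order_refl) (auto simp: subnormalized_on_def)
    then show ?thesis using h by (simp add: glue_def ennreal_SUP_add_right[OF nonempty])
  qed
  then show ?thesis using Subnormalized by (simp add: subnormalized_on_def)
next
  case Normalized
  have "glue F (\<lambda>x\<in>topspace lim. 1 + h x) = 1 + glue F h" if h: "h \<in> lsc_maps lim" for h
  proof -
    have "glue F (\<lambda>x\<in>topspace lim. 1 + h x) = (SUP i\<in>I. 1 + F i (lower_approx h i))"
      unfolding glue_add_one[OF F h] using nor lower_approx_lsc Normalized
      by (intro SUP_cong) (auto simp: normalized_on_def)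
    then show ?thesis using h by (simp add: glue_def ennreal_SUP_add_right[OF nonempty])
  qed
  then show ?thesis using Normalized by (simp add: normalized_on_def)
qed simp

lemma compatible_prevision: "compatible F \<Longrightarrow> i \<in> I \<Longrightarrow> prevision (X i) (F i)"
  by (simp add: compatible_def)

lemma compatible_eq:
  "compatible F \<Longrightarrow> i \<in> I \<Longrightarrow> j \<in> I \<Longrightarrow> le i j \<Longrightarrow> h \<in> lsc_maps (X i) \<Longrightarrow>
     F j (\<lambda>x\<in>topspace (X j). h (p i j x)) = F i h"
  by (simp add: compatible_def)

text \<open>
  Compatibility identifies \<open>F i g\<close> with \<open>F j (g \<circ> p i j)\<close>, so inequalities between functions on different spaces
  of the system can be compared at the upper one.
\<close>
lemma compatible_le:
  assumes F: "compatible F" and ij: "i \<in> I" "j \<in> I" "le i j"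
    and g: "g \<in> lsc_maps (X i)" and h: "h \<in> lsc_maps (X j)"
    and le: "\<And>z. z \<in> topspace (X j) \<Longrightarrow> g (p i j z) \<le> h z"
  shows "F i g \<le> F j h"
proof -
  have "F j (\<lambda>x\<in>topspace (X j). g (p i j x)) \<le> F j h"
    by (rule prevision_mono[OF compatible_prevision[OF F ij(2)] lsc_maps_pullback[OF continuous_p[OF ij] g] h])
       (simp add: le)
  then show ?thesis using compatible_eq[OF F ij g] by simp
qed

section \<open>Systems of embedding-projection pairs\<close>

text \<open>
  For \<open>z\<close> in \<open>X i\<close> the points \<open>e i j z\<close>, with \<open>j\<close> above \<open>i\<close>, form a thread through \<open>z\<close>. Evaluating the hypothesis on it
  gives \<open>g \<le> (SUP j. h j \<circ> e i j)\<close>, a directed supremum on \<open>X i\<close>. Moreover \<open>F i (h j \<circ> e i j) \<le> F j (h j)\<close>, because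
  lower semicontinuous functions are monotone for the specialization order and \<open>e i j \<circ> p i j \<le> id\<close>.
\<close>
lemma ep_limit_monotone:
  assumes ep: "ep_system I le X p" and F: "compatible F"
  shows "limit_monotone F"
  unfolding limit_monotone_def
proof (intro ballI allI impI)
  fix i g h
  assume i: "i \<in> I" and g: "g \<in> lsc_maps (X i)" and h: "increasing h"
    and le: "\<forall>x\<in>topspace lim. g (x i) \<le> (SUP j\<in>I. h j (x j))"
  obtain e where e: "\<forall>i\<in>I. \<forall>j\<in>I. le i j \<longrightarrow>
           continuous_map (X i) (X j) (e i j) \<and>
           (\<forall>x\<in>topspace (X i). p i j (e i j x) = x) \<and>
           (\<forall>x\<in>topspace (X j). specialization (X j) (e i j (p i j x)) x)"
    and ee': "\<forall>i\<in>I. \<forall>j\<in>I. \<forall>k\<in>I. le i j \<and> le j k \<longrightarrow>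
           (\<forall>x\<in>topspace (X i). e j k (e i j x) = e i k x)"
    using ep unfolding ep_system_def by (elim conjE exE) (rule that)
  have ce: "continuous_map (X i) (X j) (e i j)" if "i \<in> I" "j \<in> I" "le i j" for i j
    using e that by blast
  have pe: "p i j (e i j x) = x" if "i \<in> I" "j \<in> I" "le i j" "x \<in> topspace (X i)" for i j x
    using e that by blast
  have ep_le: "specialization (X j) (e i j (p i j x)) x" if "i \<in> I" "j \<in> I" "le i j" "x \<in> topspace (X j)" for i j x
    using e that by blast
  have ee: "e j k (e i j x) = e i k x"
    if "i \<in> I" "j \<in> I" "k \<in> I" "le i j" "le j k" "x \<in> topspace (X i)" for i j k x
    using ee' that by blast
  have e_in: "e i j z \<in> topspace (X j)" if "j \<in> I" "le i j" "z \<in> topspace (X i)" for j z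
    using ce[OF i that(1,2)] that(3) by (auto simp: continuous_map_def)
  let ?J = "{j \<in> I. le i j}"
  let ?k = "\<lambda>j. \<lambda>z\<in>topspace (X i). h j (e i j z)"
  have k: "?k j \<in> lsc_maps (X i)" if "j \<in> ?J" for j
    using that by (intro lsc_maps_pullback[OF ce[OF i]] increasing_lsc[OF h]) auto
  have thread: "p j l (e i l z) = e i j z" if "j \<in> ?J" "l \<in> ?J" "le j l" "z \<in> topspace (X i)" for j l z
    using ee[of i j l z] pe[of j l "e i j z"] e_in[of j z] that i by auto
  have k_mono: "?k j z \<le> ?k l z" if "j \<in> ?J" "l \<in> ?J" "le j l" "z \<in> topspace (X i)" for j l z
    using increasing_le[OF h, of j l "e i l z"] thread[OF that] e_in[of l z] that by auto
  have "g z \<le> (SUP j\<in>?J. ?k j z)" if z: "z \<in> topspace (X i)" for z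
  proof -
    obtain x where x: "x \<in> topspace lim" and xj: "\<And>j. j \<in> ?J \<Longrightarrow> x j = e i j z"
      by (rule extend_cofinal_thread[OF upper_set_cofinal[OF i], of "\<lambda>j. e i j z"])
         (use e_in z thread in auto)
    have "x i = z" using lim_thread[OF x i] xj[of i] pe[OF i i le_refl[OF i] z] p_id[OF i] e_in[OF i le_refl[OF i] z] i le_refl[OF i]
      by simp
    then have "g z \<le> (SUP j\<in>I. h j (x j))" using le x by blast
    also have "\<dots> \<le> (SUP j\<in>?J. ?k j z)"
    proof (rule SUP_least)
      fix j assume j: "j \<in> I"
      obtain l where l: "l \<in> I" "le i l" "le j l" using directed[OF i j] by blast
      have "h j (x j) \<le> h l (x l)" by (rule increasing_lim[OF h x j l(1,3)])
      also have "\<dots> = ?k l z" using xj[of l] l z by simp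
      also have "\<dots> \<le> (SUP j\<in>?J. ?k j z)" using l by (intro SUP_upper) simp
      finally show "h j (x j) \<le> (SUP j\<in>?J. ?k j z)" .
    qed
    finally show ?thesis .
  qed
  then have "F i g \<le> F i (\<lambda>z\<in>topspace (X i). SUP j\<in>?J. ?k j z)"
    by (intro prevision_mono[OF compatible_prevision[OF F i] g lsc_maps_SUP[OF k]]) simp_all
  also have "\<dots> = (SUP j\<in>?J. F i (?k j))"
  proof (rule prevision_SUP[OF compatible_prevision[OF F i] _ k])
    show "?J \<noteq> {}" using i le_refl by blast
    fix j j' assume jj: "j \<in> ?J" "j' \<in> ?J"
    then have "j \<in> I" "j' \<in> I" by auto
    then obtain l where l: "l \<in> I" "le j l" "le j' l" using directed by blast
    then have "l \<in> ?J" using jj le_trans i by blast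
    then show "\<exists>l\<in>?J. \<forall>z\<in>topspace (X i). ?k j z \<le> ?k l z \<and> ?k j' z \<le> ?k l z"
      using k_mono jj l by blast
  qed
  also have "\<dots> \<le> (SUP j\<in>I. F j (h j))"
  proof (rule SUP_least)
    fix j assume j: "j \<in> ?J"
    have "F i (?k j) \<le> F j (h j)"
    proof (rule compatible_le[OF F i])
      fix z assume z: "z \<in> topspace (X j)"
      then show "?k j (p i j z) \<le> h j z"
        using lsc_maps_specialization[OF increasing_lsc[OF h] ep_le[OF i]] p_in[OF i] j by simp
    qed (use j k increasing_lsc[OF h] in auto)
    also have "\<dots> \<le> (SUP j\<in>I. F j (h j))" using j by (intro SUP_upper) simp
    finally show "F i (?k j) \<le> (SUP j\<in>I. F j (h j))" .
  qed
  finally show "F i g \<le> (SUP j\<in>I. F j (h j))" .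
qed

section \<open>Compact families below an increasing family\<close>

lemma reindexed_system:
  assumes "cofinal_reindexing J leJ a"
  shows "inverse_system J leJ (\<lambda>j. X (a j)) (\<lambda>j k. p (a j) (a k))"
  using assms continuous_p p_id p_p
  unfolding inverse_system_def projective_system_def cofinal_reindexing_def
  by (auto simp: image_subset_iff)

lemma compact_family_below_increasing:
  assumes J: "cofinal_reindexing J leJ a"
    and sober: "\<And>i. i \<in> I \<Longrightarrow> sober_space (X i)"
    and K: "\<And>j. j \<in> J \<Longrightarrow> compactin (X (a j)) (K j)" "\<And>j. j \<in> J \<Longrightarrow> saturated_in (X (a j)) (K j)"
    and pK: "\<And>j k. j \<in> J \<Longrightarrow> k \<in> J \<Longrightarrow> leJ j k \<Longrightarrow> p (a j) (a k) ` K k \<subseteq> K j"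
    and h: "increasing h"
    and lim: "\<And>x. x \<in> topspace lim \<Longrightarrow> (\<And>j. j \<in> J \<Longrightarrow> x (a j) \<in> K j) \<Longrightarrow> \<exists>i\<in>I. t < h i (x i)"
  shows "\<exists>j\<in>J. K j \<subseteq> {z \<in> topspace (X (a j)). t < h (a j) z}"
proof -
  interpret J: inverse_system J leJ "\<lambda>j. X (a j)" "\<lambda>j k. p (a j) (a k)"
    by (rule reindexed_system[OF J])
  have aI: "a j \<in> I" if "j \<in> J" for j using J that by (auto simp: cofinal_reindexing_def)
  have aJ: "le (a j) (a k)" if "j \<in> J" "k \<in> J" "leJ j k" for j k
    using J that by (auto simp: cofinal_reindexing_def)
  show ?thesis
  proof (rule J.compact_family_inside_open)
    show "openin (X (a j)) {z \<in> topspace (X (a j)). t < h (a j) z}" if "j \<in> J" for j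
      using increasing_lsc[OF h aI[OF that]] by (rule lsc_maps_openin)
    show "z \<in> {z \<in> topspace (X (a k)). t < h (a k) z}"
      if "j \<in> J" "k \<in> J" "leJ j k" "z \<in> topspace (X (a k))"
        "p (a j) (a k) z \<in> {z \<in> topspace (X (a j)). t < h (a j) z}" for j k z
      using increasing_le[OF h aI aI aJ, OF that(1,2,1,2,3,4)] that(4,5) by (auto intro: order_less_le_trans)
    fix y assume y: "\<forall>j\<in>J. y j \<in> K j" "\<forall>j\<in>J. \<forall>k\<in>J. leJ j k \<longrightarrow> p (a j) (a k) (y k) = y j"
    have yt: "y j \<in> topspace (X (a j))" if "j \<in> J" for j
      using y(1) K(1)[OF that] that compactin_subset_topspace by blast
    obtain x where x: "x \<in> topspace lim" and xa: "\<And>j. j \<in> J \<Longrightarrow> x (a j) = y j"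
      by (rule extend_cofinal_thread[OF J, of y]) (use yt y(2) in auto)
    obtain i where i: "i \<in> I" "t < h i (x i)" using lim[OF x] xa y(1) by auto
    obtain j where j: "j \<in> J" "le i (a j)" using J i(1) unfolding cofinal_reindexing_def by blast
    have "t < h (a j) (x (a j))"
      using increasing_lim[OF h x i(1) aI[OF j(1)] j(2)] i(2) by (rule order_less_le_trans[rotated])
    then show "\<exists>j\<in>J. y j \<in> {z \<in> topspace (X (a j)). t < h (a j) z}"
      using j(1) xa yt by (intro bexI[of _ j]) auto
  qed (use K pK sober aI in auto)
qed

text \<open>
  Finitely many compact families, each with its own level, are treated one after the other; an index that works
  for one of them may be increased.
\<close>
lemma compact_families_below_increasing:
  fixes n :: nat
  assumes J: "cofinal_reindexing J leJ a"
    and sober: "\<And>i. i \<in> I \<Longrightarrow> sober_space (X i)"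
    and K: "\<And>m j. m < n \<Longrightarrow> j \<in> J \<Longrightarrow> compactin (X (a j)) (K m j)"
      "\<And>m j. m < n \<Longrightarrow> j \<in> J \<Longrightarrow> saturated_in (X (a j)) (K m j)"
    and pK: "\<And>m j k. m < n \<Longrightarrow> j \<in> J \<Longrightarrow> k \<in> J \<Longrightarrow> leJ j k \<Longrightarrow> p (a j) (a k) ` K m k \<subseteq> K m j"
    and h: "increasing h"
    and lim: "\<And>m x. m < n \<Longrightarrow> x \<in> topspace lim \<Longrightarrow> (\<And>j. j \<in> J \<Longrightarrow> x (a j) \<in> K m j) \<Longrightarrow> \<exists>i\<in>I. r m < h i (x i)"
  shows "\<exists>j\<in>J. \<forall>m<n. K m j \<subseteq> {z \<in> topspace (X (a j)). r m < h (a j) z}"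
  using K pK lim
proof (induction n)
  case 0
  then show ?case using J by (auto simp: cofinal_reindexing_def directed_on_def)
next
  case (Suc n)
  let ?W = "\<lambda>m j. {z \<in> topspace (X (a j)). r m < h (a j) z}"
  have aI: "a j \<in> I" if "j \<in> J" for j using J that by (auto simp: cofinal_reindexing_def)
  have mono: "K m k \<subseteq> ?W m k" if "m < Suc n" "j \<in> J" "k \<in> J" "leJ j k" "K m j \<subseteq> ?W m j" for m j k
  proof
    fix z assume z: "z \<in> K m k"
    have zt: "z \<in> topspace (X (a k))" using Suc.prems(1)[OF that(1,3)] z compactin_subset_topspace by blast
    have "le (a j) (a k)" using J that by (auto simp: cofinal_reindexing_def)
    then have "h (a j) (p (a j) (a k) z) \<le> h (a k) z"
      using increasing_le[OF h] aI that zt by blast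
    moreover have "p (a j) (a k) z \<in> ?W m j" using Suc.prems(3)[OF that(1-4)] z that(5) by blast
    ultimately show "z \<in> ?W m k" using zt by auto
  qed
  have "\<exists>j\<in>J. \<forall>m<n. K m j \<subseteq> ?W m j"
    by (rule Suc.IH) (use Suc.prems in \<open>auto intro: less_SucI\<close>)
  then obtain j where j: "j \<in> J" "\<And>m. m < n \<Longrightarrow> K m j \<subseteq> ?W m j" by blast
  have "\<exists>j\<in>J. K n j \<subseteq> ?W n j"
    by (rule compact_family_below_increasing[OF J sober _ _ _ h]) (use Suc.prems in auto)
  then obtain k where k: "k \<in> J" "K n k \<subseteq> ?W n k" by blast
  obtain l where l: "l \<in> J" "leJ j l" "leJ k l"
    using J j k unfolding cofinal_reindexing_def directed_on_def by blast
  have "K m l \<subseteq> ?W m l" if "m < Suc n" for m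
    using that mono[OF that j(1) l(1,2)] mono[OF that k(1) l(1,3)] j(2)[of m] k(2) less_SucE by blast
  then show ?case using l(1) by blast
qed

end

section \<open>Compact approximation by consonance and by local compactness\<close>

lemma compactin_sum_slice:
  assumes "compactin (sum_topology (\<lambda>_. X) A) Q"
  shows "compactin X {x. (m, x) \<in> Q}"
proof (cases "m \<in> A")
  case True
  let ?S = "sum_topology (\<lambda>_. X) A"
  have "closedin ?S (Sigma A (\<lambda>i. if i = m then topspace X else {}))"
    unfolding closedin_sum_topology_alt by (intro exI[of _ "\<lambda>i. if i = m then topspace X else {}"]) auto
  then have c: "compactin ?S (Q \<inter> Sigma A (\<lambda>i. if i = m then topspace X else {}))"
    using assms by (rule compact_Int_closedin[rotated])
  have cont: "continuous_map ?S X snd"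
    unfolding continuous_map_def
  proof (intro conjI allI impI)
    show "snd \<in> topspace ?S \<rightarrow> topspace X" by auto
    fix U assume U: "openin X U"
    have "{z \<in> topspace ?S. snd z \<in> U} = Sigma A (\<lambda>_. U)" using openin_subset[OF U] by auto
    then show "openin ?S {z \<in> topspace ?S. snd z \<in> U}"
      using U by (auto simp: openin_sum_topology_alt)
  qed
  have "snd ` (Q \<inter> Sigma A (\<lambda>i. if i = m then topspace X else {})) = {x. (m, x) \<in> Q}"
    using compactin_subset_topspace[OF assms] True by (force split: if_splits)
  then show ?thesis using image_compactin[OF c cont] by simp
next
  case False
  then have "{x. (m, x) \<in> Q} = {}" using compactin_subset_topspace[OF assms] by auto
  then show ?thesis by simp
qed

lemma saturated_sum_slice:
  assumes "saturated_in (sum_topology (\<lambda>_. X) A) Q"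
  shows "saturated_in X {x. (m, x) \<in> Q}"
  unfolding saturated_in_def
proof (intro conjI ballI allI impI)
  show "{x. (m, x) \<in> Q} \<subseteq> topspace X" using assms by (auto simp: saturated_in_def)
  fix x y assume x: "x \<in> {x. (m, x) \<in> Q}" and xy: "specialization X x y"
  have "m \<in> A" using x assms by (auto simp: saturated_in_def)
  then have "specialization (sum_topology (\<lambda>_. X) A) (m, x) (m, y)"
    using xy unfolding specialization_def by (auto simp: openin_sum_topology)
  then show "y \<in> {x. (m, x) \<in> Q}" using x assms unfolding saturated_in_def by blast
qed

text \<open>
  An \<open>n\<close>-tuple of open sets is an open set of the \<open>n\<close>-fold sum. The tuples whose step function has \<open>F\<close>-value above
  \<open>t\<close> form a Scott-open set, since \<open>F\<close> is Scott-continuous and step functions preserve directed unions. A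
  compact set of the sum given by consonance is a tuple of compact sets.
\<close>
lemma odot_consonant_step_function:
  assumes X: "odot_consonant_space X" and F: "prevision X F"
    and U: "\<And>m. m < n \<Longrightarrow> openin X (U m)" and t: "t < F (step_function X n r U)"
  obtains Q where "\<And>m. m < n \<Longrightarrow> compactin X (Q m)" "\<And>m. m < n \<Longrightarrow> saturated_in X (Q m)"
    "\<And>m. m < n \<Longrightarrow> Q m \<subseteq> U m"
    "\<forall>V. (\<forall>m<n. openin X (V m) \<and> Q m \<subseteq> V m) \<longrightarrow> t < F (step_function X n r V)"
proof -
  let ?S = "sum_topology (\<lambda>_. X) {..<n}"
  let ?step = "\<lambda>W. step_function X n r (\<lambda>m. {x. (m, x) \<in> W})"
  define \<U> where "\<U> = {W. openin ?S W \<and> t < F (?step W)}"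
  have step: "?step W \<in> lsc_maps X" if "openin ?S W" for W
    using that by (intro step_function_lsc) (auto simp: openin_sum_topology)
  have step_mono: "?step W x \<le> ?step W' x" if "W \<subseteq> W'" "x \<in> topspace X" for W W' x
    using that by (intro step_function_mono) auto
  have "scott_open_in {W. openin ?S W} \<U>"
    unfolding scott_open_in_def
  proof (intro conjI allI impI ballI)
    show "\<U> \<subseteq> {W. openin ?S W}" by (auto simp: \<U>_def)
    fix W W' assume W: "W \<in> \<U>" "W' \<in> {W. openin ?S W}" "W \<subseteq> W'"
    then have "F (?step W) \<le> F (?step W')"
      by (intro prevision_mono[OF F] step step_mono) (auto simp: \<U>_def)
    then show "W' \<in> \<U>" using W by (auto simp: \<U>_def)
  next
    fix D s assume "D \<subseteq> {W. openin ?S W} \<and> directed_on D (\<subseteq>) \<and> is_lub_in {W. openin ?S W} D s \<and> s \<in> \<U>"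
    then have D: "\<And>W. W \<in> D \<Longrightarrow> openin ?S W" and dir: "directed_on D (\<subseteq>)"
      and lub: "is_lub_in {W. openin ?S W} D s" and s: "openin ?S s" "t < F (?step s)" by (auto simp: \<U>_def)
    have "openin ?S (\<Union>D)" using D by blast
    then have sD: "s \<subseteq> \<Union>D" using lub unfolding is_lub_in_def by (metis Union_upper mem_Collect_eq)
    obtain W where "W \<in> D" "t < F (?step W)"
    proof (rule prevision_less_SUP[OF F, where A = D and f = ?step and g = "?step s" and t = t])
      show "D \<noteq> {}" using dir by (simp add: directed_on_def)
      fix W W' assume "W \<in> D" "W' \<in> D"
      then obtain W'' where "W'' \<in> D" "W \<subseteq> W''" "W' \<subseteq> W''" using dir unfolding directed_on_def by blast
      then show "\<exists>k\<in>D. \<forall>x\<in>topspace X. ?step W x \<le> ?step k x \<and> ?step W' x \<le> ?step k x"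
        using step_mono by blast
    next
      fix x assume x: "x \<in> topspace X"
      show "?step s x \<le> (SUP W\<in>D. ?step W x)"
      proof (rule step_function_le[OF x])
        fix m assume m: "m < n" "x \<in> {x. (m, x) \<in> s}"
        then obtain W where W: "W \<in> D" "(m, x) \<in> W" using sD by blast
        have "r m \<le> ?step W x" using x m W by (intro step_function_ge) auto
        then show "r m \<le> (SUP W\<in>D. ?step W x)" using W by (rule_tac SUP_upper2)
      qed
    qed (use s step D in auto)
    then show "D \<inter> \<U> \<noteq> {}" using D by (auto simp: \<U>_def)
  qed
  moreover have "Sigma {..<n} U \<in> \<U>"
  proof -
    have "?step (Sigma {..<n} U) = step_function X n r U" by (rule step_function_cong) auto
    then show ?thesis using U t by (auto simp: \<U>_def openin_sum_topology_alt)
  qed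
  ultimately obtain Q where Q: "compactin ?S Q" "saturated_in ?S Q" "Q \<subseteq> Sigma {..<n} U"
      and QV: "\<And>W. openin ?S W \<Longrightarrow> Q \<subseteq> W \<Longrightarrow> W \<in> \<U>"
    using X unfolding odot_consonant_space_def consonant_space_def by meson
  show thesis
  proof (rule that[of "\<lambda>m. {x. (m, x) \<in> Q}"])
    show "compactin X {x. (m, x) \<in> Q}" for m using Q(1) by (rule compactin_sum_slice)
    show "saturated_in X {x. (m, x) \<in> Q}" for m using Q(2) by (rule saturated_sum_slice)
    show "{x. (m, x) \<in> Q} \<subseteq> U m" for m using Q(3) by blast
    show "\<forall>V. (\<forall>m<n. openin X (V m) \<and> {x. (m, x) \<in> Q} \<subseteq> V m) \<longrightarrow> t < F (step_function X n r V)"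
    proof (intro allI impI)
      fix V assume "\<forall>m<n. openin X (V m) \<and> {x. (m, x) \<in> Q} \<subseteq> V m"
      then have V: "\<And>m. m < n \<Longrightarrow> openin X (V m)" "\<And>m. m < n \<Longrightarrow> {x. (m, x) \<in> Q} \<subseteq> V m" by blast+
      have "Q \<subseteq> Sigma {..<n} V" using Q(3) V(2) by blast
      moreover have "openin ?S (Sigma {..<n} V)" using V(1) by (auto simp: openin_sum_topology_alt)
      ultimately have "Sigma {..<n} V \<in> \<U>" using QV by blast
      moreover have "?step (Sigma {..<n} V) = step_function X n r V" by (rule step_function_cong) auto
      ultimately show "t < F (step_function X n r V)" by (simp add: \<U>_def)
    qed
  qed
qed

lemma compactin_saturation:
  assumes Q: "compactin X Q"
  shows "compactin X {y. \<exists>x\<in>Q. specialization X x y}"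
  unfolding compactin_def
proof (intro conjI allI impI)
  show "{y. \<exists>x\<in>Q. specialization X x y} \<subseteq> topspace X" by (auto simp: specialization_def)
  fix \<U> assume \<U>: "Ball \<U> (openin X) \<and> {y. \<exists>x\<in>Q. specialization X x y} \<subseteq> \<Union>\<U>"
  have "Q \<subseteq> \<Union>\<U>"
  proof
    fix x assume x: "x \<in> Q"
    then have "specialization X x x" using compactin_subset_topspace[OF Q] by (auto simp: specialization_def)
    then show "x \<in> \<Union>\<U>" using x \<U> by blast
  qed
  then obtain \<F> where \<F>: "finite \<F>" "\<F> \<subseteq> \<U>" "Q \<subseteq> \<Union>\<F>" using Q \<U> unfolding compactin_def by meson
  have "{y. \<exists>x\<in>Q. specialization X x y} \<subseteq> \<Union>\<F>"
  proof clarify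
    fix x y assume x: "x \<in> Q" and xy: "specialization X x y"
    then obtain W where W: "W \<in> \<F>" "x \<in> W" using \<F>(3) by blast
    then have "openin X W" using \<F>(2) \<U> by blast
    then have "y \<in> W" using xy W(2) by (simp add: specialization_def)
    then show "y \<in> \<Union>\<F>" using W(1) by blast
  qed
  then show "\<exists>\<F>. finite \<F> \<and> \<F> \<subseteq> \<U> \<and> {y. \<exists>x\<in>Q. specialization X x y} \<subseteq> \<Union>\<F>" using \<F> by blast
qed

lemma saturated_saturation: "saturated_in X {y. \<exists>x\<in>Q. specialization X x y}"
  unfolding saturated_in_def specialization_def by blast

text \<open>
  The saturation of a compact set is compact and stays inside every open set that contains the compact set.
\<close>
lemma locally_compact_base_saturated:
  assumes "locally_compact_base X" "openin X W" "x \<in> W"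
  obtains V Q where "openin X V" "x \<in> V" "V \<subseteq> Q" "Q \<subseteq> W" "compactin X Q" "saturated_in X Q"
proof -
  obtain V K where VK: "openin X V" "compactin X K" "x \<in> V" "V \<subseteq> K" "K \<subseteq> W"
    using assms unfolding locally_compact_base_def neighbourhood_base_of by meson
  let ?Q = "{y. \<exists>x\<in>K. specialization X x y}"
  have "V \<subseteq> ?Q" using VK openin_subset[OF VK(1)] by (auto simp: specialization_def)
  moreover have "?Q \<subseteq> W" using VK assms(2) by (auto simp: specialization_def)
  ultimately show thesis
    using that VK compactin_saturation[OF VK(2)] saturated_saturation by blast
qed

text \<open>
  Each \<open>U m\<close> is the directed union of the open sets \<open>V\<close> for which a compact saturated set lies between \<open>V\<close> and
  \<open>U m\<close>. So the step function on the \<open>U m\<close> is a directed supremum of step functions on such \<open>V\<close>, and \<open>F\<close> is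
  Scott-continuous.
\<close>
lemma locally_compact_step_function:
  assumes X: "locally_compact_base X" and F: "prevision X F"
    and U: "\<And>m. m < n \<Longrightarrow> openin X (U m)" and t: "t < F (step_function X n r U)"
  obtains V Q where
    "\<forall>m<n. openin X (V m) \<and> V m \<subseteq> Q m \<and> Q m \<subseteq> U m \<and> compactin X (Q m) \<and> saturated_in X (Q m)"
    "t < F (step_function X n r V)"
proof -
  let ?P = "\<lambda>m V Q. V \<subseteq> Q \<and> Q \<subseteq> U m \<and> compactin X Q \<and> saturated_in X Q"
  define A where "A = {V. \<forall>m<n. openin X (V m) \<and> (\<exists>Q. ?P m (V m) Q)}"
  have empty: "?P m {} {}" for m by (simp add: saturated_in_def)
  obtain V where "V \<in> A" "t < F (step_function X n r V)"
  proof (rule prevision_less_SUP[OF F, where A = A and f = "step_function X n r" and g = "step_function X n r U" and t = t])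
    have "(\<lambda>_. {}) \<in> A" unfolding A_def using empty by (auto intro!: exI[of _ "{}"])
    then show "A \<noteq> {}" by blast
    show "step_function X n r V \<in> lsc_maps X" if "V \<in> A" for V
      using that by (intro step_function_lsc) (auto simp: A_def)
    fix V V' assume VV: "V \<in> A" "V' \<in> A"
    have "(\<lambda>m. V m \<union> V' m) \<in> A"
      unfolding A_def
    proof (intro CollectI allI impI conjI)
      fix m assume m: "m < n"
      show "openin X (V m \<union> V' m)" using VV m by (auto simp: A_def)
      obtain Q Q' where "?P m (V m) Q" "?P m (V' m) Q'" using VV m unfolding A_def by blast
      then have "?P m (V m \<union> V' m) (Q \<union> Q')"
        by (auto intro: compactin_Un simp: saturated_in_def)
      then show "\<exists>Q. ?P m (V m \<union> V' m) Q" by blast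
    qed
    then show "\<exists>k\<in>A. \<forall>x\<in>topspace X. step_function X n r V x \<le> step_function X n r k x \<and>
        step_function X n r V' x \<le> step_function X n r k x"
      by (intro bexI[of _ "\<lambda>m. V m \<union> V' m"] ballI conjI step_function_mono) auto
  next
    fix x assume x: "x \<in> topspace X"
    show "step_function X n r U x \<le> (SUP V\<in>A. step_function X n r V x)"
    proof (rule step_function_le[OF x])
      fix m assume m: "m < n" "x \<in> U m"
      obtain V Q where V: "openin X V" "x \<in> V" "?P m V Q"
        using locally_compact_base_saturated[OF X U[OF m(1)] m(2)] by metis
      \<comment> \<open>At the point \<open>x\<close> only the level \<open>m\<close> has to be kept.\<close>
      let ?V = "\<lambda>k. if k = m then V else {}"
      have "openin X (?V k) \<and> (\<exists>Q. ?P k (?V k) Q)" for k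
        using V(1,3) empty[of k] by (cases "k = m") (simp, blast, simp, blast)
      then have "?V \<in> A" unfolding A_def by blast
      moreover have "r m \<le> step_function X n r ?V x" using x m V by (intro step_function_ge) auto
      ultimately show "r m \<le> (SUP V\<in>A. step_function X n r V x)"
        by (intro SUP_upper2[of ?V A])
    qed
  qed (use t U in \<open>auto intro: step_function_lsc\<close>)
  then have "\<forall>m. \<exists>Q. m < n \<longrightarrow> ?P m (V m) Q" "\<And>m. m < n \<Longrightarrow> openin X (V m)"
    unfolding A_def by blast+
  then obtain Q where "\<And>m. m < n \<Longrightarrow> ?P m (V m) (Q m)" by metis
  then show thesis using that[of V Q] \<open>\<And>m. m < n \<Longrightarrow> openin X (V m)\<close> \<open>t < F (step_function X n r V)\<close> by blast
qed

context inverse_system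
begin

section \<open>Consonant spaces with proper maps\<close>

text \<open>
  Properness is used twice. Preimages of the compact saturated sets \<open>Q m\<close> given by consonance are compact saturated,
  so the compactness theorem finds \<open>j\<close> with \<open>h j > r m\<close> on the preimage of \<open>Q m\<close>. To return to \<open>X i\<close>, let \<open>V m\<close> be the
  complement of the downward closure of the image of \<open>{h j \<le> r m}\<close>. It is open, it contains \<open>Q m\<close> since \<open>Q m\<close> is
  saturated, and its preimage lies in \<open>{h j > r m}\<close>. So the step function on the \<open>V m\<close> has value above \<open>t\<close> and, pulled
  back to \<open>X j\<close>, lies below \<open>h j\<close>.
\<close>
lemma proper_odot_consonant_limit_monotone:
  assumes cons: "\<And>i. i \<in> I \<Longrightarrow> odot_consonant_space (X i)"
    and sober: "\<And>i. i \<in> I \<Longrightarrow> sober_space (X i)"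
    and proper: "\<And>i j. i \<in> I \<Longrightarrow> j \<in> I \<Longrightarrow> le i j \<Longrightarrow> order_proper_map (X j) (X i) (p i j)"
    and F: "compatible F"
  shows "limit_monotone F"
  unfolding limit_monotone_def
proof (intro ballI allI impI)
  fix i g h
  assume i: "i \<in> I" and g: "g \<in> lsc_maps (X i)" and h: "increasing h"
    and le: "\<forall>x\<in>topspace lim. g (x i) \<le> (SUP j\<in>I. h j (x j))"
  show "F i g \<le> (SUP j\<in>I. F j (h j))"
  proof (rule dense_le)
    fix t assume t: "t < F i g"
    note pr = compatible_prevision[OF F i]
    obtain n r where step: "t < F i (step_function (X i) n r (\<lambda>m. {x \<in> topspace (X i). r m < g x}))"
      using prevision_step_function[OF pr g t] .
    obtain Q where Q: "\<And>m. m < n \<Longrightarrow> compactin (X i) (Q m)" "\<And>m. m < n \<Longrightarrow> saturated_in (X i) (Q m)"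
        "\<And>m. m < n \<Longrightarrow> Q m \<subseteq> {x \<in> topspace (X i). r m < g x}"
      and QV: "\<forall>V. (\<forall>m<n. openin (X i) (V m) \<and> Q m \<subseteq> V m) \<longrightarrow> t < F i (step_function (X i) n r V)"
      by (rule odot_consonant_step_function[OF cons[OF i] pr lsc_maps_openin[OF g] step]) (rule that; ((simp; fail) | blast))
    let ?J = "{j \<in> I. le i j}"
    let ?K = "\<lambda>m j. {z \<in> topspace (X j). p i j z \<in> Q m}"
    have "\<exists>j\<in>?J. \<forall>m<n. ?K m j \<subseteq> {z \<in> topspace (X j). r m < h j z}"
    proof (rule compact_families_below_increasing[OF upper_set_cofinal[OF i] sober _ _ _ h])
      fix m j assume m: "m < n" and j: "j \<in> ?J"
      show "compactin (X j) (?K m j)" "saturated_in (X j) (?K m j)"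
        using proper[OF i, of j] j Q(1,2)[OF m] unfolding order_proper_map_def by blast+
    next
      fix m j k assume m: "m < n" and jk: "j \<in> ?J" "k \<in> ?J" "le j k"
      show "p j k ` ?K m k \<subseteq> ?K m j"
        using jk p_in[of j k] p_p[OF i, of j k] by auto
    next
      fix m x assume m: "m < n" and x: "x \<in> topspace lim" "\<And>j. j \<in> ?J \<Longrightarrow> x j \<in> ?K m j"
      have "x i \<in> Q m" using x(2)[of i] i le_refl[OF i] p_id[OF i] by auto
      then have "r m < g (x i)" using Q(3)[OF m] by blast
      also have "\<dots> \<le> (SUP j\<in>I. h j (x j))" using le x(1) by blast
      finally show "\<exists>j\<in>I. r m < h j (x j)" by (simp add: less_SUP_iff)
    qed
    then obtain j where j: "j \<in> I" "le i j" and Kj: "\<And>m. m < n \<Longrightarrow> ?K m j \<subseteq> {z \<in> topspace (X j). r m < h j z}"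
      by blast
    have hj: "h j \<in> lsc_maps (X j)" using increasing_lsc[OF h j(1)] .
    let ?C = "\<lambda>m. {z \<in> topspace (X j). \<not> r m < h j z}"
    define V where "V = (\<lambda>m. topspace (X i) - down_closure (X i) (p i j ` ?C m))"
    have V: "openin (X i) (V m)" for m
    proof -
      have "?C m = topspace (X j) - {z \<in> topspace (X j). r m < h j z}" by auto
      then have "closedin (X j) (?C m)" using lsc_maps_openin[OF hj] by (simp add: closedin_def Diff_Diff_Int Int_absorb1)
      then show ?thesis using proper[OF i j] unfolding order_proper_map_def V_def by blast
    qed
    have "Q m \<subseteq> V m" if m: "m < n" for m
    proof
      fix x assume x: "x \<in> Q m"
      have "x \<notin> down_closure (X i) (p i j ` ?C m)"
      proof
        assume "x \<in> down_closure (X i) (p i j ` ?C m)"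
        then obtain z where z: "z \<in> ?C m" "specialization (X i) x (p i j z)"
          by (auto simp: down_closure_def)
        then have "p i j z \<in> Q m" using Q(2)[OF m] x unfolding saturated_in_def by blast
        then show False using Kj[OF m] z(1) by blast
      qed
      then show "x \<in> V m" using x Q(3)[OF m] unfolding V_def by blast
    qed
    then have "t < F i (step_function (X i) n r V)" using QV V by blast
    also have "\<dots> \<le> F j (h j)"
    proof (rule compatible_le[OF F i j step_function_lsc[OF V] hj])
      fix z assume z: "z \<in> topspace (X j)"
      show "step_function (X i) n r V (p i j z) \<le> h j z"
      proof (rule step_function_le[OF p_in[OF i j z]])
        fix m assume m: "m < n" "p i j z \<in> V m"
        have "z \<notin> ?C m"
        proof
          assume "z \<in> ?C m"
          then have "p i j z \<in> down_closure (X i) (p i j ` ?C m)"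
            using p_in[OF i j z] unfolding down_closure_def specialization_def by blast
          then show False using m(2) by (simp add: V_def)
        qed
        then show "r m \<le> h j z" using z by auto
      qed
    qed
    also have "\<dots> \<le> (SUP j\<in>I. F j (h j))" using j by (intro SUP_upper)
    finally show "t \<le> (SUP j\<in>I. F j (h j))" by simp
  qed
qed

section \<open>Countable systems of locally compact spaces\<close>

text \<open>
  The next index is chosen above the current one and above the next element of an enumeration of the cofinal set.
\<close>
lemma cofinal_sequence:
  assumes count: "has_countable_cofinal_subset I le" and i: "i \<in> I"
  obtains a :: "nat \<Rightarrow> 'i" where "a 0 = i" "cofinal_reindexing UNIV (\<le>) a"
proof -
  obtain C where C: "C \<subseteq> I" "countable C" "\<And>i. i \<in> I \<Longrightarrow> \<exists>j\<in>C. le i j"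
    using count unfolding has_countable_cofinal_subset_def by blast
  have "C \<noteq> {}" using C(3)[OF i] by blast
  then have c: "range (from_nat_into C) = C" using C(2) by (rule range_from_nat_into)
  have "\<exists>a. \<forall>n. (a n \<in> I \<and> (n = 0 \<longrightarrow> a n = i)) \<and> (le (a n) (a (Suc n)) \<and> le (from_nat_into C n) (a (Suc n)))"
  proof (rule dependent_nat_choice)
    show "\<exists>x. x \<in> I \<and> ((0::nat) = 0 \<longrightarrow> x = i)" using i by blast
    fix x :: 'i and n :: nat assume x: "x \<in> I \<and> (n = 0 \<longrightarrow> x = i)"
    have "from_nat_into C n \<in> I" using c C(1) by blast
    then obtain y where "y \<in> I" "le x y" "le (from_nat_into C n) y" using directed x by blast
    then show "\<exists>y. (y \<in> I \<and> (Suc n = 0 \<longrightarrow> y = i)) \<and> (le x y \<and> le (from_nat_into C n) y)" by auto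
  qed
  then obtain a where a: "\<And>n. a n \<in> I" "a 0 = i" "\<And>n. le (a n) (a (Suc n))"
    "\<And>n. le (from_nat_into C n) (a (Suc n))" by blast
  have mono: "le (a m) (a n)" if "m \<le> n" for m n
    using that
  proof (induction rule: dec_induct)
    case base
    then show ?case by (rule le_refl[OF a(1)])
  next
    case (step n)
    then show ?case using le_trans a by blast
  qed
  have "\<exists>n. le k (a n)" if k: "k \<in> I" for k
  proof -
    obtain d where d: "d \<in> C" "le k d" using C(3)[OF k] by blast
    then obtain n where "d = from_nat_into C n" using c by (metis rangeE)
    then show ?thesis using le_trans[OF d(2) a(4)[of n, folded \<open>d = _\<close>] k] d C(1) a(1) by blast
  qed
  then have "cofinal_reindexing UNIV (\<le>) a"
    unfolding cofinal_reindexing_def using a(1) mono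
    by (auto simp: reflp_on_def transp_on_def directed_on_def) (metis nat_le_linear)
  then show thesis using that a(2) by blast
qed

text \<open>
  Along a cofinal sequence \<open>a\<close> starting at \<open>i\<close>, one chooses open sets \<open>V k m\<close> and compact saturated sets \<open>Q m k\<close> in
  \<open>X (a k)\<close> with \<open>V k m \<subseteq> Q m k\<close>, where \<open>Q m (Suc k)\<close> lies over \<open>V k m\<close> and \<open>Q m 0\<close> lies inside \<open>{g > r m}\<close>, such that the
  step function on the \<open>V k m\<close> always has value above \<open>t\<close>. The step exists because \<open>F\<close> takes the same value on the step
  function pulled back to the next space, where local compactness applies. The compact sets form a compatible
  family, so that some \<open>h (a k)\<close> exceeds \<open>r m\<close> on \<open>Q m k\<close> for all \<open>m\<close>, hence dominates the \<open>k\<close>-th step function.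
\<close>
lemma countable_locally_compact_limit_monotone:
  assumes count: "has_countable_cofinal_subset I le"
    and lc: "\<And>i. i \<in> I \<Longrightarrow> locally_compact_base (X i)"
    and sober: "\<And>i. i \<in> I \<Longrightarrow> sober_space (X i)"
    and F: "compatible F"
  shows "limit_monotone F"
  unfolding limit_monotone_def
proof (intro ballI allI impI)
  fix i g h
  assume i: "i \<in> I" and g: "g \<in> lsc_maps (X i)" and h: "increasing h"
    and le: "\<forall>x\<in>topspace lim. g (x i) \<le> (SUP j\<in>I. h j (x j))"
  show "F i g \<le> (SUP j\<in>I. F j (h j))"
  proof (rule dense_le)
    fix t assume t: "t < F i g"
    obtain a :: "nat \<Rightarrow> 'i" where a0: "a 0 = i" and a: "cofinal_reindexing UNIV (\<le>) a"
      using cofinal_sequence[OF count i] .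
    have aI: "a k \<in> I" for k using a by (auto simp: cofinal_reindexing_def)
    have a_mono: "le (a k) (a l)" if "k \<le> l" for k l using a that by (auto simp: cofinal_reindexing_def)
    note pr = compatible_prevision[OF F aI]
    obtain n r where g': "t < F i (step_function (X i) n r (\<lambda>m. {x \<in> topspace (X i). r m < g x}))"
      using prevision_step_function[OF compatible_prevision[OF F i] g t] .
    \<comment> \<open>The data of stage \<open>k\<close>: open sets \<open>V m\<close> that still carry a value above \<open>t\<close>, and compact sets around them.\<close>
    define good where "good = (\<lambda>k (V, Q).
       (\<forall>m<n. openin (X (a k)) (V m) \<and> V m \<subseteq> Q m \<and> compactin (X (a k)) (Q m) \<and> saturated_in (X (a k)) (Q m)) \<and>
       t < F (a k) (step_function (X (a k)) n r V))"
    have "\<exists>VQ. \<forall>k. (good k (VQ k) \<and> (k = 0 \<longrightarrow> (\<forall>m<n. snd (VQ k) m \<subseteq> {x \<in> topspace (X i). r m < g x}))) \<and>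
        (\<forall>m<n. p (a k) (a (Suc k)) ` snd (VQ (Suc k)) m \<subseteq> fst (VQ k) m)"
    proof (rule dependent_nat_choice)
      obtain V Q where
        "\<forall>m<n. openin (X i) (V m) \<and> V m \<subseteq> Q m \<and> Q m \<subseteq> {x \<in> topspace (X i). r m < g x} \<and>
           compactin (X i) (Q m) \<and> saturated_in (X i) (Q m)"
        "t < F i (step_function (X i) n r V)"
        using locally_compact_step_function[OF lc[OF i] compatible_prevision[OF F i] lsc_maps_openin[OF g] g'] .
      then have "good 0 (V, Q) \<and> (\<forall>m<n. snd (V, Q) m \<subseteq> {x \<in> topspace (X i). r m < g x})"
        by (simp add: good_def a0)
      then show "\<exists>VQ. good 0 VQ \<and> ((0::nat) = 0 \<longrightarrow> (\<forall>m<n. snd VQ m \<subseteq> {x \<in> topspace (X i). r m < g x}))"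
        by blast
    next
      fix VQ :: "(nat \<Rightarrow> 'a set) \<times> (nat \<Rightarrow> 'a set)" and k
      assume "good k VQ \<and> (k = 0 \<longrightarrow> (\<forall>m<n. snd VQ m \<subseteq> {x \<in> topspace (X i). r m < g x}))"
      then obtain V Q where VQ: "VQ = (V, Q)" and V: "\<And>m. m < n \<Longrightarrow> openin (X (a k)) (V m)"
        and tV: "t < F (a k) (step_function (X (a k)) n r V)"
        by (cases VQ) (auto simp: good_def)
      note k = aI[of k] aI[of "Suc k"] a_mono[of k "Suc k", simplified]
      let ?U = "\<lambda>m. {z \<in> topspace (X (a (Suc k))). p (a k) (a (Suc k)) z \<in> V m}"
      have U: "openin (X (a (Suc k))) (?U m)" if "m < n" for m
        using V[OF that] continuous_p[OF k] by (rule openin_continuous_map_preimage[rotated])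
      have "F (a k) (step_function (X (a k)) n r V) \<le> F (a (Suc k)) (step_function (X (a (Suc k))) n r ?U)"
      proof (rule compatible_le[OF F k step_function_lsc[OF V] step_function_lsc[OF U]])
        fix z assume z: "z \<in> topspace (X (a (Suc k)))"
        show "step_function (X (a k)) n r V (p (a k) (a (Suc k)) z) \<le> step_function (X (a (Suc k))) n r ?U z"
          by (rule step_function_le[OF p_in[OF k z]], rule step_function_ge[OF z]) (use z in auto)
      qed
      with tV have tU: "t < F (a (Suc k)) (step_function (X (a (Suc k))) n r ?U)" by (rule order_less_le_trans)
      obtain V' Q' where
        VQ': "\<forall>m<n. openin (X (a (Suc k))) (V' m) \<and> V' m \<subseteq> Q' m \<and> Q' m \<subseteq> ?U m \<and>
           compactin (X (a (Suc k))) (Q' m) \<and> saturated_in (X (a (Suc k))) (Q' m)"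
        and tV': "t < F (a (Suc k)) (step_function (X (a (Suc k))) n r V')"
        using locally_compact_step_function[OF lc[OF k(2)] pr U tU] .
      have "good (Suc k) (V', Q')" using VQ' tV' by (simp add: good_def)
      moreover have "\<forall>m<n. p (a k) (a (Suc k)) ` snd (V', Q') m \<subseteq> fst VQ m" using VQ' VQ by fastforce
      ultimately show "\<exists>VQ'. (good (Suc k) VQ' \<and> (Suc k = 0 \<longrightarrow> (\<forall>m<n. snd VQ' m \<subseteq> {x \<in> topspace (X i). r m < g x}))) \<and>
        (\<forall>m<n. p (a k) (a (Suc k)) ` snd VQ' m \<subseteq> fst VQ m)" by blast
    qed
    then obtain VQ where *: "\<forall>k. (good k (VQ k) \<and> (k = 0 \<longrightarrow> (\<forall>m<n. snd (VQ k) m \<subseteq> {x \<in> topspace (X i). r m < g x}))) \<and>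
        (\<forall>m<n. p (a k) (a (Suc k)) ` snd (VQ (Suc k)) m \<subseteq> fst (VQ k) m)" ..
    have good: "good k (VQ k)" for k using * by (elim allE[of _ k] conjE)
    have Q0: "snd (VQ 0) m \<subseteq> {x \<in> topspace (X i). r m < g x}" if "m < n" for m
      using *[rule_format, of 0] that by simp
    have pQ: "p (a k) (a (Suc k)) ` snd (VQ (Suc k)) m \<subseteq> fst (VQ k) m" if "m < n" for k m
      using *[rule_format, of k] that by simp
    let ?V = "\<lambda>k. fst (VQ k)" and ?Q = "\<lambda>m k. snd (VQ k) m"
    have VQ: "openin (X (a k)) (?V k m)" "?V k m \<subseteq> ?Q m k" "compactin (X (a k)) (?Q m k)" "saturated_in (X (a k)) (?Q m k)"
      if "m < n" for k m using good[of k] that by (auto simp: good_def split_beta)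
    have tV: "t < F (a k) (step_function (X (a k)) n r (?V k))" for k
      using good[of k] by (simp add: good_def split_beta)
    have "\<exists>k\<in>UNIV. \<forall>m<n. ?Q m k \<subseteq> {z \<in> topspace (X (a k)). r m < h (a k) z}"
    proof (rule compact_families_below_increasing[OF a sober VQ(3,4) _ h])
      fix m k l :: nat assume m: "m < n" and "k \<le> l"
      from \<open>k \<le> l\<close> show "p (a k) (a l) ` ?Q m l \<subseteq> ?Q m k"
      proof (induction rule: dec_induct)
        case base
        have "?Q m k \<subseteq> topspace (X (a k))" using VQ(3)[OF m] by (rule compactin_subset_topspace)
        then show ?case using p_id[OF aI] by force
      next
        case (step l)
        show ?case
        proof (rule image_subsetI)
          fix z assume z: "z \<in> ?Q m (Suc l)"
          have zt: "z \<in> topspace (X (a (Suc l)))" using z VQ(3)[OF m] compactin_subset_topspace by blast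
          have "p (a l) (a (Suc l)) z \<in> ?Q m l" using z pQ[OF m] VQ(2)[OF m] by blast
          then have "p (a k) (a l) (p (a l) (a (Suc l)) z) \<in> ?Q m k" using step.IH by blast
          then show "p (a k) (a (Suc l)) z \<in> ?Q m k"
            using p_p[OF aI aI aI a_mono a_mono zt, of k l] step.hyps by simp
        qed
      qed
    next
      fix m x assume m: "m < n" and x: "x \<in> topspace lim" "\<And>k. k \<in> UNIV \<Longrightarrow> x (a k) \<in> ?Q m k"
      have "r m < g (x i)" using x(2)[of 0] Q0[OF m] a0 by auto
      also have "\<dots> \<le> (SUP j\<in>I. h j (x j))" using le x(1) by blast
      finally show "\<exists>j\<in>I. r m < h j (x j)" by (simp add: less_SUP_iff)
    qed
    then obtain k where k: "\<And>m. m < n \<Longrightarrow> ?Q m k \<subseteq> {z \<in> topspace (X (a k)). r m < h (a k) z}" by blast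
    note tV[of k]
    also have "F (a k) (step_function (X (a k)) n r (?V k)) \<le> F (a k) (h (a k))"
    proof (rule prevision_mono[OF pr step_function_lsc[OF VQ(1)] increasing_lsc[OF h aI]])
      fix z assume z: "z \<in> topspace (X (a k))"
      show "step_function (X (a k)) n r (?V k) z \<le> h (a k) z"
      proof (rule step_function_le[OF z])
        fix m assume m: "m < n" "z \<in> ?V k m"
        then have "r m < h (a k) z" using VQ(2)[OF m(1)] k[OF m(1)] by blast
        then show "r m \<le> h (a k) z" by simp
      qed
    qed
    also have "\<dots> \<le> (SUP j\<in>I. F j (h j))" using aI by (intro SUP_upper)
    finally show "t \<le> (SUP j\<in>I. F j (h j))" by simp
  qed
qed

section \<open>The limit of the spaces of previsions\<close>

lemma AP_projective_system:
  "projective_system I le (\<lambda>i. AP_space b (X i)) (\<lambda>i j. AP_map (X j) (X i) (p i j))"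
  unfolding projective_system_def
proof (intro conjI ballI impI)
  show "reflp_on I le" "transp_on I le" "directed_on I le" using system by (auto simp: projective_system_def)
  show "continuous_map (AP_space b (X j)) (AP_space b (X i)) (AP_map (X j) (X i) (p i j))"
    if "i \<in> I" "j \<in> I" "le i j" for i j
    using continuous_p[OF that] by (rule continuous_AP_map)
  show "AP_map (X i) (X i) (p i i) F = F" if "i \<in> I" "F \<in> topspace (AP_space b (X i))" for i F
    using that p_id by (intro AP_map_id) (auto simp: topspace_AP_space)
  show "AP_map (X j) (X i) (p i j) (AP_map (X k) (X j) (p j k) F) = AP_map (X k) (X i) (p i k) F"
    if "i \<in> I" "j \<in> I" "k \<in> I" "le i j \<and> le j k" "F \<in> topspace (AP_space b (X k))" for i j k F
    using that p_p by (intro AP_map_comp continuous_p) auto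
qed

text \<open>
  Gluing is inverse to the comparison map. Its continuity rests on the fact that \<open>glue G h > r\<close> is witnessed by one
  coordinate of \<open>G\<close>, evaluated at one lower semicontinuous function.
\<close>
lemma AP_projective_limit:
  assumes limit_monotone: "\<And>F. compatible F \<Longrightarrow> limit_monotone F"
  shows "is_projective_limit I le
           (\<lambda>i. AP_space b (X i)) (\<lambda>i j. AP_map (X j) (X i) (p i j))
           (AP_space b lim) (\<lambda>i. AP_map lim (X i) (\<lambda>x. x i))"
proof -
  interpret AP: inverse_system I le "\<lambda>i. AP_space b (X i)" "\<lambda>i j. AP_map (X j) (X i) (p i j)"
    by unfold_locales (rule AP_projective_system)
  let ?\<Phi> = "\<lambda>F. \<lambda>i\<in>I. AP_map lim (X i) (\<lambda>x. x i) F"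
  have G_in: "G i \<in> AP_previsions b (X i)" if "G \<in> topspace AP.lim" "i \<in> I" for G i
    using AP.lim_coordinate[OF that] by (simp add: topspace_AP_space)
  have comp: "compatible G" if G: "G \<in> topspace AP.lim" for G
    unfolding compatible_def
  proof (intro conjI ballI impI)
    show "prevision (X i) (G i)" if "i \<in> I" for i using G_in[OF G that] by (simp add: AP_previsions_def)
    fix i j h assume ij: "i \<in> I" "j \<in> I" "le i j" "h \<in> lsc_maps (X i)"
    have "AP_map (X j) (X i) (p i j) (G j) h = G i h" using AP.lim_thread[OF G ij(1-3)] by simp
    then show "G j (\<lambda>x\<in>topspace (X j). h (p i j x)) = G i h" using ij by (simp add: AP_map_def)
  qed
  have glue_in: "glue G \<in> AP_previsions b lim" if G: "G \<in> topspace AP.lim" for G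
  proof -
    note c = comp[OF G] limit_monotone[OF comp[OF G]]
    show ?thesis
      using glue_prevision[OF c] glue_sublinear[OF c] glue_normality[OF c] G_in[OF G]
      by (auto simp: AP_previsions_def)
  qed
  have \<Phi>_cont: "continuous_map (AP_space b lim) AP.lim ?\<Phi>"
    unfolding projective_limit_def[of I le "\<lambda>i. AP_space b (X i)"]
  proof (rule continuous_map_into_subtopology)
    show "continuous_map (AP_space b lim) (product_topology (\<lambda>i. AP_space b (X i)) I) ?\<Phi>"
      unfolding continuous_map_componentwise
      using continuous_AP_map[OF continuous_coordinate] by auto
    have "AP_map (X j) (X i) (p i j) (AP_map lim (X j) (\<lambda>x. x j) F) = AP_map lim (X i) (\<lambda>x. x i) F"
      if "i \<in> I" "j \<in> I" "le i j" for i j F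
      using that by (intro AP_map_comp continuous_coordinate continuous_p lim_thread)
    then show "?\<Phi> \<in> topspace (AP_space b lim) \<rightarrow>
       {x \<in> (\<Pi>\<^sub>E i\<in>I. topspace (AP_space b (X i))). \<forall>i\<in>I. \<forall>j\<in>I. le i j \<longrightarrow> AP_map (X j) (X i) (p i j) (x j) = x i}"
      using AP_map_preserves[OF continuous_coordinate] by (auto simp: topspace_AP_space)
  qed
  have glue_cont: "continuous_map AP.lim (AP_space b lim) glue"
  proof (rule continuous_map_into_AP_space)
    show "glue ` topspace AP.lim \<subseteq> AP_previsions b lim" using glue_in by blast
    fix h and r :: real assume h: "h \<in> lsc_maps lim" "0 \<le> r"
    have "{G \<in> topspace AP.lim. ennreal r < glue G h} =
       (\<Union>i\<in>I. {G \<in> topspace AP.lim. G i \<in> {F \<in> AP_previsions b (X i). ennreal r < F (lower_approx h i)}})"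
      using h G_in by (auto simp: glue_def less_SUP_iff)
    moreover have "openin AP.lim {G \<in> topspace AP.lim. G i \<in> {F \<in> AP_previsions b (X i). ennreal r < F (lower_approx h i)}}"
      if "i \<in> I" for i
      using AP.continuous_coordinate[OF that] openin_AP_space[OF lower_approx_lsc h(2)]
      by (rule openin_continuous_map_preimage)
    ultimately show "openin AP.lim {G \<in> topspace AP.lim. ennreal r < glue G h}" by auto
  qed
  have glue_\<Phi>: "glue (?\<Phi> F) = F" if F: "F \<in> topspace (AP_space b lim)" for F
  proof
    fix h
    have F': "prevision lim F" using F by (simp add: topspace_AP_space AP_previsions_def)
    show "glue (?\<Phi> F) h = F h"
    proof (cases "h \<in> lsc_maps lim")
      case True
      then have "glue (?\<Phi> F) h = (SUP i\<in>I. F (\<lambda>x\<in>topspace lim. lower_approx h i (x i)))"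
        using lower_approx_lsc by (simp add: glue_def AP_map_def cong: SUP_cong)
      then show ?thesis using prevision_on_lim[OF F' True] by simp
    next
      case False
      then show ?thesis using F' by (simp add: glue_def prevision_def extensional_def)
    qed
  qed
  have \<Phi>_glue: "?\<Phi> (glue G) = G" if G: "G \<in> topspace AP.lim" for G
  proof (rule extensionalityI)
    show "G \<in> extensional I" using G by (auto simp: AP.topspace_lim PiE_def)
    fix i assume i: "i \<in> I"
    have ext: "G i \<in> extensional (lsc_maps (X i))"
      using G_in[OF G i] by (simp add: AP_previsions_def prevision_def)
    have "AP_map lim (X i) (\<lambda>x. x i) (glue G) = G i"
    proof (rule extensionalityI[OF _ ext])
      fix h assume "h \<in> lsc_maps (X i)"
      then show "AP_map lim (X i) (\<lambda>x. x i) (glue G) h = G i h"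
        using glue_coordinate[OF comp[OF G] limit_monotone[OF comp[OF G]] i] by (simp add: AP_map_def)
    qed (simp add: AP_map_def)
    then show "?\<Phi> (glue G) i = G i" using i by simp
  qed simp
  have "homeomorphic_maps (AP_space b lim) AP.lim ?\<Phi> glue"
    unfolding homeomorphic_maps_def using \<Phi>_cont glue_cont glue_\<Phi> \<Phi>_glue by blast
  then show ?thesis
    unfolding is_projective_limit_def homeomorphic_map_maps by blast
qed

end

theorem theorem13p8:
  fixes I :: "'i set" and le :: "'i \<Rightarrow> 'i \<Rightarrow> bool"
    and X :: "'i \<Rightarrow> 'a topology" and p :: "'i \<Rightarrow> 'i \<Rightarrow> 'a \<Rightarrow> 'a"
    and b :: normality
  assumes "projective_system I le X p"
    and "ep_system I le X p
       \<or> (has_countable_cofinal_subset I le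
          \<and> (\<forall>i\<in>I. locally_compact_base (X i) \<and> sober_space (X i)
                   \<and> (b = Normalized \<longrightarrow> compact_space (X i))))
       \<or> ((\<forall>i\<in>I. odot_consonant_space (X i) \<and> sober_space (X i)
                   \<and> (b = Normalized \<longrightarrow> compact_space (X i)))
          \<and> (\<forall>i\<in>I. \<forall>j\<in>I. le i j \<longrightarrow> order_proper_map (X j) (X i) (p i j)))"
  shows "projective_system I le (\<lambda>i. AP_space b (X i)) (\<lambda>i j. AP_map (X j) (X i) (p i j))
       \<and> is_projective_limit I le
           (\<lambda>i. AP_space b (X i)) (\<lambda>i j. AP_map (X j) (X i) (p i j))
           (AP_space b (projective_limit I le X p))
           (\<lambda>i. AP_map (projective_limit I le X p) (X i) (\<lambda>x. x i))"
proof -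
  interpret inverse_system I le X p by unfold_locales (rule assms(1))
  have "limit_monotone F" if "compatible F" for F
    using assms(2) ep_limit_monotone[OF _ that] countable_locally_compact_limit_monotone[OF _ _ _ that]
      proper_odot_consonant_limit_monotone[OF _ _ _ that]
    by (elim disjE) blast+
  then show ?thesis using AP_projective_system AP_projective_limit by blast
qed

end
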